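(* Let $\widetilde G(z)\in\mathcal{L}_n^p$ and let $\widetilde R=(\widetilde A,\widetilde B,\widetilde C,\widetilde D)$ be a balanced realization of $\widetilde G(z)$ in Schur form ($\widetilde A$ upper triangular). Let $$\widetilde A=\begin{pmatrix}w&a^*\\0&A\end{pmatrix},\qquad\widetilde B=\begin{pmatrix}b^*\\ B\end{pmatrix},\qquad\widetilde C=\begin{pmatrix}u&\hat C\end{pmatrix},$$ where $w\in\mathbb{C}$, $u,b\in\mathbb{C}^p$ and $a\in\mathbb{C}^{n-1}$. Then $\widetilde G=T_{\hat\Theta_{w,u,0}}(G)$ for some lossless function $G(z)$. A realization $R$ of $G(z)$ can be computed by reverting the recursion $$\begin{pmatrix}\widetilde D&\widetilde C\\\widetilde B&\widetilde A\end{pmatrix}=\begin{pmatrix}\mathcal{U}&0\\0&I_{n-1}\end{pmatrix}\begin{pmatrix}D&0&C\\0&1&0\\ B&0&A\end{pmatrix}\begin{pmatrix}\mathcal{V}^*&0\\0&I_{n-1}\end{pmatrix},\qquad(\mathcal{U},\mathcal{V})=\tau(w,u,0);$$ it is still in Schur form and is given by $R=(A,B,C,D)$, where $$C=\hat C+(1-w)^{-1}u\,a^*,\qquad D=\widetilde D+(1-w)^{-1}u\,b^*.$$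
   Context: $^*$ denotes conjugate transpose, $M^{-*}=(M^{-1})^*$, $J=\begin{pmatrix}I_p&0\\0&-I_p\end{pmatrix}$; square roots of positive definite matrices are the Hermitian positive ones. A $p\times p$ rational matrix function $G$ is lossless if $G(z)G(z)^*\le I_p$ for $|z|>1$, with equality for $|z|=1$; $\mathcal{L}_n^p$ is the set of $p\times p$ lossless functions of McMillan degree $n$. A realization $(A,B,C,D)$ of $G$ means $G(z)=D+C(zI-A)^{-1}B$; for a lossless function, a balanced realization is a minimal realization for which the realization matrix $\begin{pmatrix}D&C\\ B&A\end{pmatrix}$ is unitary. For $\Theta=(\Theta_{ij})_{i,j=1,2}$ with $p\times p$ blocks, $T_\Theta(F)=(\Theta_{11}F+\Theta_{12})(\Theta_{21}F+\Theta_{22})^{-1}$. Let $W\in\mathbb{C}^{\delta\times\delta}$ be stable (eigenvalues in the open unit disk), $U,V\in\mathbb{C}^{p\times\delta}$, $(U,W)$ observable with $U^*U+W^*W=I_\delta$, and such that the solution $P$ of $P-W^*PW=U^*U-V^*V$ is positive definite. (In the lemma, $\delta=1$, $W=w$, $U=u$, $V=0$.) Let $T=P^{1/2}$, $\tilde U=UT^{-1}$, $\tilde W=TWT^{-1}$, $\tilde V=VT^{-1}$, $X=I_p-U(I_\delta-W^* )^{-1}U^*$, $Y=(I_\delta-W)(I_\delta-W^* )^{-1}U^*$, $K=\tilde U^*\tilde U+\tilde W^*\tilde W=I_\delta+\tilde V^*\tilde V$, $L=\tilde U^*X+\tilde W^*TY$, $Z=X^*X+Y^*P^{-1}Y$.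 Then $\tau(W,U,V)=(\mathcal{U},\mathcal{V})$ with the unitary matrices $$\mathcal{U}=\begin{pmatrix}X&\tilde U\\ TY&\tilde W\end{pmatrix}\begin{pmatrix}Z^{1/2}&0\\-K^{-1}LZ^{1/2}&K^{-1/2}\end{pmatrix},\qquad\mathcal{V}=\begin{pmatrix}(I_p+\tilde V\tilde V^* )^{-1/2}&\tilde V(I_\delta+\tilde V^*\tilde V)^{-1/2}\\-\tilde V^*(I_p+\tilde V\tilde V^* )^{-1/2}&(I_\delta+\tilde V^*\tilde V)^{-1/2}\end{pmatrix}.$$ Write $\mathcal{U}=\begin{pmatrix}M_u&\alpha_u\\\beta_u^*&K_u\end{pmatrix}$, $\mathcal{V}=\begin{pmatrix}M_v&\alpha_v\\\beta_v^*&K_v\end{pmatrix}$ ($M_u,M_v$ of size $p\times p$), $M=\begin{pmatrix}M_u&0\\0&M_v\end{pmatrix}$, $\alpha=\begin{pmatrix}\alpha_u\\\alpha_v\end{pmatrix}$, $\beta=\begin{pmatrix}\beta_u\\\beta_v\end{pmatrix}$, $H_{\mathcal{U},\mathcal{V}}=M+\alpha(K_v-K_u)^{-1}\beta^*J$. With $\mathcal{C}=\begin{pmatrix}U\\ V\end{pmatrix}$, $\Theta_{W,U,V}(z)=I_{2p}-(z-1)\mathcal{C}(zI_\delta-W)^{-1}P^{-1}(I_\delta-W)^{-*}\mathcal{C}^*J$, and $\hat\Theta_{W,U,V}=\Theta_{W,U,V}H_{\mathcal{U},\mathcal{V}}$. *)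

theory Defs
  imports
    "HOL-Computational_Algebra.Field_as_Ring"
    "HOL-Computational_Algebra.Polynomial_Factorial"
    "Jordan_Normal_Form.Spectral_Radius"
begin

subsection \<open>Complex matrices\<close>

abbreviation adjoint_mat :: "complex mat \<Rightarrow> complex mat" (\<open>(_\<^sup>H)\<close> [1000] 999) where
  "A\<^sup>H \<equiv> mat_adjoint A"

definition hermitian :: "nat \<Rightarrow> complex mat \<Rightarrow> bool" where
  "hermitian n A \<longleftrightarrow> A \<in> carrier_mat n n \<and> A\<^sup>H = A"

text \<open>For Hermitian \<open>A\<close> the number \<open>(A v) \<bullet>c v = v\<^sup>H A v\<close> is real, so only its real part matters.\<close>

definition pos_semidef :: "nat \<Rightarrow> complex mat \<Rightarrow> bool" where
  "pos_semidef n A \<longleftrightarrow> hermitian n A \<and> (\<forall>v \<in> carrier_vec n. Re ((A *\<^sub>v v) \<bullet>c v) \<ge> 0)"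

definition pos_def :: "nat \<Rightarrow> complex mat \<Rightarrow> bool" where
  "pos_def n A \<longleftrightarrow> hermitian n A \<and>
     (\<forall>v \<in> carrier_vec n. v \<noteq> 0\<^sub>v n \<longrightarrow> Re ((A *\<^sub>v v) \<bullet>c v) > 0)"

definition unitary_mat :: "nat \<Rightarrow> complex mat \<Rightarrow> bool" where
  "unitary_mat n A \<longleftrightarrow> A \<in> carrier_mat n n \<and> A * A\<^sup>H = 1\<^sub>m n \<and> A\<^sup>H * A = 1\<^sub>m n"

text \<open>The square root of a positive definite matrix is the positive definite one.\<close>

definition mat_sqrt :: "complex mat \<Rightarrow> complex mat" where
  "mat_sqrt A = (THE S. pos_def (dim_row A) S \<and> S * S = A)"

text \<open>Only meaningful for invertible square matrices, like \<open>mat_inverse\<close>.\<close>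

definition mat_inv :: "'a :: field mat \<Rightarrow> 'a mat" where
  "mat_inv A = the (mat_inverse A)"

text \<open>Horizontal juxtaposition, the counterpart of \<open>A @\<^sub>r B\<close>.\<close>

definition append_cols :: "'a :: zero mat \<Rightarrow> 'a mat \<Rightarrow> 'a mat" (infixr \<open>@\<^sub>c\<close> 65) where
  "A @\<^sub>c B = four_block_mat A B (0\<^sub>m 0 (dim_col A)) (0\<^sub>m 0 (dim_col B))"


subsection \<open>Rational matrix functions\<close>

text \<open>A rational matrix function is a matrix over the field of rational functions in one
  variable, \<open>complex poly fract\<close>; identities between rational matrix functions are identities
  over that field.\<close>

definition var_z :: "complex poly fract" where
  "var_z = to_fract [:0, 1:]"

definition const_mat :: "complex mat \<Rightarrow> complex poly fract mat" where
  "const_mat A = map_mat (\<lambda>c. to_fract [:c:]) A"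

definition resolvent :: "complex mat \<Rightarrow> complex poly fract mat" where
  "resolvent A = mat_inv (var_z \<cdot>\<^sub>m 1\<^sub>m (dim_row A) - const_mat A)"

text \<open>\<open>quot_of_fract\<close> returns numerator and denominator in lowest terms, so the poles are
  exactly the zeros of the denominator.\<close>

definition rat_pole :: "complex poly fract \<Rightarrow> complex \<Rightarrow> bool" where
  "rat_pole r z \<longleftrightarrow> poly (snd (quot_of_fract r)) z = 0"

definition rat_eval :: "complex poly fract \<Rightarrow> complex \<Rightarrow> complex" where
  "rat_eval r z = poly (fst (quot_of_fract r)) z / poly (snd (quot_of_fract r)) z"

definition mat_eval :: "complex poly fract mat \<Rightarrow> complex \<Rightarrow> complex mat" where
  "mat_eval G z = map_mat (\<lambda>r. rat_eval r z) G"

text \<open>The conditions on \<open>G(z)\<close> presuppose that \<open>G\<close> is defined at \<open>z\<close>.\<close>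

definition lossless :: "nat \<Rightarrow> complex poly fract mat \<Rightarrow> bool" where
  "lossless p G \<longleftrightarrow> G \<in> carrier_mat p p \<and>
     (\<forall>z. cmod z \<ge> 1 \<longrightarrow> (\<forall>i < p. \<forall>j < p. \<not> rat_pole (G $$ (i, j)) z)) \<and>
     (\<forall>z. cmod z > 1 \<longrightarrow> pos_semidef p (1\<^sub>m p - mat_eval G z * (mat_eval G z)\<^sup>H)) \<and>
     (\<forall>z. cmod z = 1 \<longrightarrow> mat_eval G z * (mat_eval G z)\<^sup>H = 1\<^sub>m p)"


subsection \<open>Realizations\<close>

definition realization ::
  "nat \<Rightarrow> nat \<Rightarrow> complex poly fract mat \<Rightarrow>
   complex mat \<Rightarrow> complex mat \<Rightarrow> complex mat \<Rightarrow> complex mat \<Rightarrow> bool" where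
  "realization p n G A B C D \<longleftrightarrow>
     A \<in> carrier_mat n n \<and> B \<in> carrier_mat n p \<and> C \<in> carrier_mat p n \<and> D \<in> carrier_mat p p \<and>
     G = const_mat D + const_mat C * resolvent A * const_mat B"

text \<open>The McMillan degree of a proper rational function (lossless functions are proper) is the
  state dimension of its smallest realizations; these are the minimal ones.\<close>

definition mcmillan_degree :: "nat \<Rightarrow> complex poly fract mat \<Rightarrow> nat" where
  "mcmillan_degree p G = (LEAST n. \<exists>A B C D. realization p n G A B C D)"

definition lossless_deg :: "nat \<Rightarrow> nat \<Rightarrow> complex poly fract mat set" where
  "lossless_deg p n = {G. lossless p G \<and> mcmillan_degree p G = n}"

definition minimal_realization ::
  "nat \<Rightarrow> nat \<Rightarrow> complex poly fract mat \<Rightarrow>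
   complex mat \<Rightarrow> complex mat \<Rightarrow> complex mat \<Rightarrow> complex mat \<Rightarrow> bool" where
  "minimal_realization p n G A B C D \<longleftrightarrow>
     realization p n G A B C D \<and> mcmillan_degree p G = n"

definition balanced_realization ::
  "nat \<Rightarrow> nat \<Rightarrow> complex poly fract mat \<Rightarrow>
   complex mat \<Rightarrow> complex mat \<Rightarrow> complex mat \<Rightarrow> complex mat \<Rightarrow> bool" where
  "balanced_realization p n G A B C D \<longleftrightarrow>
     minimal_realization p n G A B C D \<and> unitary_mat (p + n) (four_block_mat D C B A)"


subsection \<open>The map \<open>\<tau>\<close> and the linear fractional transformation\<close>

definition stable_mat :: "complex mat \<Rightarrow> bool" where
  "stable_mat W \<longleftrightarrow> (\<forall>k. eigenvalue W k \<longrightarrow> cmod k < 1)"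

definition observable :: "nat \<Rightarrow> nat \<Rightarrow> complex mat \<Rightarrow> complex mat \<Rightarrow> bool" where
  "observable p d U W \<longleftrightarrow>
     (\<forall>x \<in> carrier_vec d. (\<forall>k. (U * W ^\<^sub>m k) *\<^sub>v x = 0\<^sub>v p) \<longrightarrow> x = 0\<^sub>v d)"

text \<open>For stable \<open>W\<close> the Stein equation has exactly one solution.\<close>

definition stein_solution :: "complex mat \<Rightarrow> complex mat \<Rightarrow> complex mat \<Rightarrow> complex mat" where
  "stein_solution W U V = (THE P. P \<in> carrier_mat (dim_row W) (dim_row W) \<and>
     P - W\<^sup>H * P * W = U\<^sup>H * U - V\<^sup>H * V)"

definition tau_admissible :: "nat \<Rightarrow> nat \<Rightarrow> complex mat \<Rightarrow> complex mat \<Rightarrow> complex mat \<Rightarrow> bool" where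
  "tau_admissible p d W U V \<longleftrightarrow>
     W \<in> carrier_mat d d \<and> U \<in> carrier_mat p d \<and> V \<in> carrier_mat p d \<and>
     stable_mat W \<and> observable p d U W \<and> U\<^sup>H * U + W\<^sup>H * W = 1\<^sub>m d \<and>
     pos_def d (stein_solution W U V)"

definition tau :: "complex mat \<Rightarrow> complex mat \<Rightarrow> complex mat \<Rightarrow> complex mat \<times> complex mat" where
  "tau W U V = (let
     p = dim_row U;
     d = dim_row W;
     P = stein_solution W U V;
     T = mat_sqrt P;
     U' = U * mat_inv T;
     W' = T * W * mat_inv T;
     V' = V * mat_inv T;
     X = 1\<^sub>m p - U * mat_inv (1\<^sub>m d - W\<^sup>H) * U\<^sup>H;
     Y = (1\<^sub>m d - W) * mat_inv (1\<^sub>m d - W\<^sup>H) * U\<^sup>H;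
     K = U'\<^sup>H * U' + W'\<^sup>H * W';
     L = U'\<^sup>H * X + W'\<^sup>H * T * Y;
     Z = X\<^sup>H * X + Y\<^sup>H * mat_inv P * Y;
     N1 = mat_inv (mat_sqrt (1\<^sub>m p + V' * V'\<^sup>H));
     N2 = mat_inv (mat_sqrt (1\<^sub>m d + V'\<^sup>H * V'))
   in (four_block_mat X U' (T * Y) W' *
       four_block_mat (mat_sqrt Z) (0\<^sub>m p d)
         (- (mat_inv K * L * mat_sqrt Z)) (mat_inv (mat_sqrt K)),
       four_block_mat N1 (V' * N2) (- (V'\<^sup>H * N1)) N2))"

definition sig_J :: "nat \<Rightarrow> complex mat" where
  "sig_J p = four_block_mat (1\<^sub>m p) (0\<^sub>m p p) (0\<^sub>m p p) (- 1\<^sub>m p)"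

text \<open>The lower left blocks of the two unitary matrices are already the adjoints
  \<open>\<beta>\<^sub>u\<^sup>H\<close> and \<open>\<beta>\<^sub>v\<^sup>H\<close>.\<close>

definition H_mat :: "nat \<Rightarrow> complex mat \<Rightarrow> complex mat \<Rightarrow> complex mat" where
  "H_mat p UU VV = (case split_block UU p p of (Mu, \<alpha>u, \<beta>uH, Ku) \<Rightarrow>
     case split_block VV p p of (Mv, \<alpha>v, \<beta>vH, Kv) \<Rightarrow>
       four_block_mat Mu (0\<^sub>m p p) (0\<^sub>m p p) Mv +
       (\<alpha>u @\<^sub>r \<alpha>v) * mat_inv (Kv - Ku) * (\<beta>uH @\<^sub>c \<beta>vH) * sig_J p)"

definition Theta :: "complex mat \<Rightarrow> complex mat \<Rightarrow> complex mat \<Rightarrow> complex poly fract mat" where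
  "Theta W U V = (let p = dim_row U; d = dim_row W in
     1\<^sub>m (2 * p) - (var_z - 1) \<cdot>\<^sub>m
       (const_mat (U @\<^sub>r V) * resolvent W *
        const_mat (mat_inv (stein_solution W U V) * (mat_inv (1\<^sub>m d - W))\<^sup>H *
                   (U @\<^sub>r V)\<^sup>H * sig_J p)))"

definition Theta_hat :: "complex mat \<Rightarrow> complex mat \<Rightarrow> complex mat \<Rightarrow> complex poly fract mat" where
  "Theta_hat W U V = (case tau W U V of (UU, VV) \<Rightarrow>
     Theta W U V * const_mat (H_mat (dim_row U) UU VV))"

text \<open>\<open>G = T\<^bsub>\<Theta>\<^esub>(F)\<close>, including that the transformation is defined at \<open>F\<close>.\<close>

definition is_LFT ::
  "nat \<Rightarrow> complex poly fract mat \<Rightarrow> complex poly fract mat \<Rightarrow> complex poly fract mat \<Rightarrow> bool" where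
  "is_LFT p \<Theta> F G \<longleftrightarrow> (case split_block \<Theta> p p of (\<Theta>11, \<Theta>12, \<Theta>21, \<Theta>22) \<Rightarrow>
     invertible_mat (\<Theta>21 * F + \<Theta>22) \<and>
     G = (\<Theta>11 * F + \<Theta>12) * mat_inv (\<Theta>21 * F + \<Theta>22))"

text \<open>The recursion, for state dimensions \<open>1 + m\<close> of \<open>(At, Bt, Ct, Dt)\<close> and \<open>m\<close> of
  \<open>(A, B, C, D)\<close>.\<close>

definition recursion ::
  "nat \<Rightarrow> nat \<Rightarrow> complex mat \<Rightarrow> complex mat \<Rightarrow>
   complex mat \<Rightarrow> complex mat \<Rightarrow> complex mat \<Rightarrow> complex mat \<Rightarrow>
   complex mat \<Rightarrow> complex mat \<Rightarrow> complex mat \<Rightarrow> complex mat \<Rightarrow> bool" where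
  "recursion p m UU VV At Bt Ct Dt A B C D \<longleftrightarrow>
     four_block_mat Dt Ct Bt At =
       four_block_mat UU (0\<^sub>m (p + 1) m) (0\<^sub>m m (p + 1)) (1\<^sub>m m) *
       four_block_mat
         (four_block_mat D (0\<^sub>m p 1) (0\<^sub>m 1 p) (1\<^sub>m 1)) (C @\<^sub>r 0\<^sub>m 1 m)
         (B @\<^sub>c 0\<^sub>m m 1) A *
       four_block_mat (VV\<^sup>H) (0\<^sub>m (p + 1) m) (0\<^sub>m m (p + 1)) (1\<^sub>m m)"

end

theory Submission
  imports Defs
begin

text \<open>
  Write \<open>R\<close> for the realization matrix of \<open>(A, B, C, D)\<close> and \<open>R~\<close> for the given one. The first
  state column of \<open>R~\<close> is \<open>(u; w; 0)\<close>. Since \<open>R~\<close> is unitary, this column has norm one,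
  \<open>u\<^sup>H u + |w|\<^sup>2 = 1\<close>, and it is orthogonal to the other columns:
  \<open>u\<^sup>H Chat = - cnj w a\<^sup>H\<close> and \<open>u\<^sup>H Dt = - cnj w b\<^sup>H\<close> (\<open>unitary_schur_relations\<close>). Minimality
  gives \<open>u \<noteq> 0\<close>, because a state that is not seen by the output can be dropped
  (\<open>schur_column_nonzero\<close>); hence \<open>|w| < 1\<close>.

  With one state and \<open>V = 0\<close> the Stein equation has the solution \<open>P = 1\<close>, and all auxiliary
  matrices of \<open>\<tau>\<close> become trivial: \<open>T = K = 1\<close>, \<open>L = 0\<close>, \<open>Z = 1\<close>. So \<open>UU = (X u; Y w)\<close> and
  \<open>VV = 1\<close> (\<open>tau_eq\<close>), the constant factor \<open>H\<close> is the identity (\<open>H_mat_eq\<close>), and \<open>Theta_hat\<close> is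
  block diagonal with the Blaschke-Potapov factor
  \<open>\<Theta> = 1 - (z - 1) / ((z - w) (1 - cnj w)) u u\<^sup>H\<close> and the identity on the diagonal
  (\<open>Theta_hat_eq\<close>). The linear fractional transformation is therefore \<open>G \<mapsto> \<Theta> G\<close>.

  The recursion leaves \<open>A\<close> and \<open>B\<close> alone and reads \<open>X D = Dt\<close>, \<open>Y D = b\<^sup>H\<close>, \<open>X C = Chat\<close>,
  \<open>Y C = a\<^sup>H\<close> (\<open>recursion_iff\<close>). The column \<open>(X; Y)\<close> is an isometry, so these equations are
  inverted by its adjoint, and the orthogonality relations turn the result into the closed
  formulas for \<open>C\<close> and \<open>D\<close> (\<open>step_inverse\<close>). An isometry preserves inner products of columns
  (\<open>gram_transfer\<close>), so \<open>R\<close> inherits unitarity from \<open>R~\<close>.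

  A transfer function with a unitary realization is lossless
  (\<open>lossless_if_unitary_realization\<close>) because
  \<open>1 - G(z) G(z)\<^sup>H = (|z|\<^sup>2 - 1) N N\<^sup>H\<close> with \<open>N = C (z - A)^-1\<close>. The matrix \<open>A\<close> is only known to be a
  contraction at this point, so it could have eigenvalues on the unit circle; they are not poles
  of \<open>G\<close>, since \<open>G\<close> is bounded by one outside the disc.

  Finally \<open>Gt = \<Theta> G\<close>: by block triangularity both transfer functions are a common term \<open>F\<close>
  plus a scalar multiple of \<open>u E\<close>, with scalar \<open>1 / (z - w)\<close> for \<open>Gt\<close> and \<open>1 / (1 - w)\<close> for \<open>G\<close>,
  and \<open>\<Theta>\<close> exchanges the two scalars (\<open>blaschke_factor\<close>).
\<close>

section \<open>Adjoints, block matrices and inverses\<close>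

lemma adjoint_dims [simp]:
  "dim_row (A\<^sup>H) = dim_col A" "dim_col (A\<^sup>H) = dim_row A"
  by (simp_all add: mat_adjoint_def)

lemma adjoint_index [simp]:
  "i < dim_col A \<Longrightarrow> j < dim_row A \<Longrightarrow> A\<^sup>H $$ (i, j) = cnj (A $$ (j, i))"
  by (simp add: mat_adjoint_def mat_of_rows_def)

lemma adjoint_carrier [simp]: "A\<^sup>H \<in> carrier_mat m n \<longleftrightarrow> A \<in> carrier_mat n m"
  unfolding carrier_mat_def by auto

lemma adjoint_adjoint [simp]: "(A\<^sup>H)\<^sup>H = A"
  by (rule eq_matI) auto

lemma adjoint_one [simp]: "(1\<^sub>m n)\<^sup>H = 1\<^sub>m n"
  and adjoint_zero [simp]: "(0\<^sub>m m n)\<^sup>H = 0\<^sub>m n m"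
  and adjoint_smult [simp]: "(c \<cdot>\<^sub>m A)\<^sup>H = cnj c \<cdot>\<^sub>m A\<^sup>H"
  by (rule eq_matI; auto)+

lemma adjoint_add:
  "A \<in> carrier_mat m n \<Longrightarrow> B \<in> carrier_mat m n \<Longrightarrow> (A + B)\<^sup>H = A\<^sup>H + B\<^sup>H"
  and adjoint_minus:
  "A \<in> carrier_mat m n \<Longrightarrow> B \<in> carrier_mat m n \<Longrightarrow> (A - B)\<^sup>H = A\<^sup>H - B\<^sup>H"
  by (rule eq_matI; auto)+

lemma adjoint_mult:
  "A \<in> carrier_mat m n \<Longrightarrow> B \<in> carrier_mat n k \<Longrightarrow> (A * B)\<^sup>H = B\<^sup>H * A\<^sup>H"
  by (rule eq_matI) (auto simp: scalar_prod_def mult.commute intro!: sum.cong)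

lemma adjoint_four_block:
  assumes "A \<in> carrier_mat r1 c1" "B \<in> carrier_mat r1 c2"
    "C \<in> carrier_mat r2 c1" "D \<in> carrier_mat r2 c2"
  shows "(four_block_mat A B C D)\<^sup>H = four_block_mat (A\<^sup>H) (C\<^sup>H) (B\<^sup>H) (D\<^sup>H)"
  by (rule eq_matI) (use assms in auto)

lemma append_cols_dims [simp]:
  "dim_row (A @\<^sub>c B) = dim_row A" "dim_col (A @\<^sub>c B) = dim_col A + dim_col B"
  by (simp_all add: append_cols_def)

lemma append_cols_index [simp]:
  "i < dim_row A \<Longrightarrow> j < dim_col A + dim_col B \<Longrightarrow>
    (A @\<^sub>c B) $$ (i, j) = (if j < dim_col A then A $$ (i, j) else B $$ (i, j - dim_col A))"
  by (simp add: append_cols_def)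

lemma append_rows_dims [simp]:
  "dim_row (A @\<^sub>r B) = dim_row A + dim_row B" "dim_col (A @\<^sub>r B) = dim_col A"
  by (simp_all add: append_rows_def)

lemma append_rows_index [simp]:
  "i < dim_row A + dim_row B \<Longrightarrow> j < dim_col A \<Longrightarrow>
    (A @\<^sub>r B) $$ (i, j) = (if i < dim_row A then A $$ (i, j) else B $$ (i - dim_row A, j))"
  by (simp add: append_rows_def)

lemma append_cols_carrier [intro]:
  "A \<in> carrier_mat r c1 \<Longrightarrow> B \<in> carrier_mat r c2 \<Longrightarrow> A @\<^sub>c B \<in> carrier_mat r (c1 + c2)"
  unfolding carrier_mat_def by auto

lemma adjoint_append_rows:
  "A \<in> carrier_mat r1 c \<Longrightarrow> B \<in> carrier_mat r2 c \<Longrightarrow> (A @\<^sub>r B)\<^sup>H = A\<^sup>H @\<^sub>c B\<^sup>H"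
  and adjoint_append_cols:
  "A' \<in> carrier_mat r c1 \<Longrightarrow> B' \<in> carrier_mat r c2 \<Longrightarrow> (A' @\<^sub>c B')\<^sup>H = A'\<^sup>H @\<^sub>r B'\<^sup>H"
  by (rule eq_matI; auto)+

lemma append_cols_mult_append_rows:
  fixes A :: "'a :: comm_ring_1 mat"
  assumes "A \<in> carrier_mat m n1" "B \<in> carrier_mat m n2"
    "C \<in> carrier_mat n1 k" "D \<in> carrier_mat n2 k"
  shows "(A @\<^sub>c B) * (C @\<^sub>r D) = A * C + B * D"
proof -
  have "(A @\<^sub>c B) * (C @\<^sub>r D) =
    four_block_mat A B (0\<^sub>m 0 n1) (0\<^sub>m 0 n2) * four_block_mat C (0\<^sub>m n1 0) D (0\<^sub>m n2 0)"
    using assms unfolding append_cols_def append_rows_def by auto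
  also have "\<dots> = four_block_mat (A * C + B * D) (0\<^sub>m m 0) (0\<^sub>m 0 k) (0\<^sub>m 0 0)"
    using assms by (subst mult_four_block_mat[OF assms(1,2) _ _ assms(3) _ assms(4)]) auto
  also have "\<dots> = A * C + B * D"
    by (rule eq_matI) (use assms in auto)
  finally show ?thesis .
qed

lemma mult_append_cols:
  fixes A :: "'a :: comm_ring_1 mat"
  assumes "A \<in> carrier_mat r m" "B \<in> carrier_mat m c1" "C \<in> carrier_mat m c2"
  shows "A * (B @\<^sub>c C) = A * B @\<^sub>c A * C"
  by (rule eq_matI) (use assms in \<open>auto simp: scalar_prod_def\<close>)

lemma append_rows_mult_append_cols:
  fixes A :: "'a :: comm_ring_1 mat"
  assumes "A \<in> carrier_mat r1 m" "B \<in> carrier_mat r2 m"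
    "C \<in> carrier_mat m c1" "D \<in> carrier_mat m c2"
  shows "(A @\<^sub>r B) * (C @\<^sub>c D) = four_block_mat (A * C) (A * D) (B * C) (B * D)"
  by (rule eq_matI) (use assms in \<open>auto simp: scalar_prod_def\<close>)

lemma four_block_eq_iff:
  assumes "A \<in> carrier_mat r1 c1" "B \<in> carrier_mat r1 c2"
    "C \<in> carrier_mat r2 c1" "D \<in> carrier_mat r2 c2"
   and "A' \<in> carrier_mat r1 c1" "B' \<in> carrier_mat r1 c2"
    "C' \<in> carrier_mat r2 c1" "D' \<in> carrier_mat r2 c2"
  shows "four_block_mat A B C D = four_block_mat A' B' C' D' \<longleftrightarrow>
    A = A' \<and> B = B' \<and> C = C' \<and> D = D'" (is "?L = ?R \<longleftrightarrow> _")
proof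
  assume eq: "?L = ?R"
  have E: "?L $$ (i, j) = ?R $$ (i, j)" for i j by (simp add: eq)
  have "A = A'"
  proof (rule eq_matI)
    fix i j assume "i < dim_row A'" "j < dim_col A'"
    thus "A $$ (i, j) = A' $$ (i, j)" using E[of i j] assms by auto
  qed (use assms in auto)
  moreover have "B = B'"
  proof (rule eq_matI)
    fix i j assume "i < dim_row B'" "j < dim_col B'"
    thus "B $$ (i, j) = B' $$ (i, j)" using E[of i "c1 + j"] assms by auto
  qed (use assms in auto)
  moreover have "C = C'"
  proof (rule eq_matI)
    fix i j assume "i < dim_row C'" "j < dim_col C'"
    thus "C $$ (i, j) = C' $$ (i, j)" using E[of "r1 + i" j] assms by auto
  qed (use assms in auto)
  moreover have "D = D'"
  proof (rule eq_matI)
    fix i j assume "i < dim_row D'" "j < dim_col D'"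
    thus "D $$ (i, j) = D' $$ (i, j)" using E[of "r1 + i" "c1 + j"] assms by auto
  qed (use assms in auto)
  ultimately show "A = A' \<and> B = B' \<and> C = C' \<and> D = D'" by simp
qed simp

lemma append_cols_eq_iff:
  assumes "A \<in> carrier_mat r c1" "B \<in> carrier_mat r c2"
   and "A' \<in> carrier_mat r c1" "B' \<in> carrier_mat r c2"
  shows "A @\<^sub>c B = A' @\<^sub>c B' \<longleftrightarrow> A = A' \<and> B = B'"
  using four_block_eq_iff[OF assms(1,2) _ _ assms(3,4), of "0\<^sub>m 0 c1" 0 "0\<^sub>m 0 c2" "0\<^sub>m 0 c1" "0\<^sub>m 0 c2"]
    assms by (auto simp: append_cols_def)

lemma append_rows_eq_iff:
  assumes "A \<in> carrier_mat r1 c" "B \<in> carrier_mat r2 c"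
   and "A' \<in> carrier_mat r1 c" "B' \<in> carrier_mat r2 c"
  shows "A @\<^sub>r B = A' @\<^sub>r B' \<longleftrightarrow> A = A' \<and> B = B'"
  using four_block_eq_iff[OF assms(1) _ assms(2) _ assms(3) _ assms(4), of "0\<^sub>m r1 0" 0 "0\<^sub>m r2 0" "0\<^sub>m r1 0" "0\<^sub>m r2 0"]
    assms by (auto simp: append_rows_def)

text \<open>Over a field a one-sided inverse of a square matrix is two-sided, so exhibiting a right
  inverse determines \<open>mat_inv\<close>.\<close>

lemma mat_inv_eqI:
  fixes A :: "'a :: field mat"
  assumes A: "A \<in> carrier_mat n n" and B: "B \<in> carrier_mat n n" and AB: "A * B = 1\<^sub>m n"
  shows "mat_inv A = B"
proof -
  have BA: "B * A = 1\<^sub>m n" by (rule mat_mult_left_right_inverse[OF A B AB])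
  have "A \<in> Units (ring_mat TYPE('a) n ())"
    unfolding Units_def ring_mat_def using A B AB BA by auto
  with mat_inverse(1)[OF A, of "()"] obtain C where C: "mat_inverse A = Some C"
    by (cases "mat_inverse A") auto
  from mat_inverse(2)[OF A C] have CA: "C * A = 1\<^sub>m n" and Cc: "C \<in> carrier_mat n n" by auto
  have "C = C * (A * B)" using AB Cc by simp
  also have "\<dots> = (C * A) * B" using assoc_mult_mat[OF Cc A B] by simp
  also have "\<dots> = B" using CA B by simp
  finally show ?thesis using C by (simp add: mat_inv_def)
qed

lemma append_cols_mult_four_block:
  fixes P :: "'a :: comm_ring_1 mat"
  assumes "P \<in> carrier_mat r n1" "Q \<in> carrier_mat r n2"
    "A \<in> carrier_mat n1 c1" "B \<in> carrier_mat n1 c2" "C \<in> carrier_mat n2 c1" "D \<in> carrier_mat n2 c2"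
  shows "(P @\<^sub>c Q) * four_block_mat A B C D = (P * A + Q * C) @\<^sub>c (P * B + Q * D)"
  unfolding append_cols_def
  by (subst mult_four_block_mat[of _ r n1 _ n2 _ 0 _ _ c1 _ c2]) (use assms in auto)

lemma four_block_mult_append_rows:
  fixes A :: "'a :: comm_ring_1 mat"
  assumes "A \<in> carrier_mat r1 c1" "B \<in> carrier_mat r1 c2" "C \<in> carrier_mat r2 c1" "D \<in> carrier_mat r2 c2"
    "P \<in> carrier_mat c1 k" "Q \<in> carrier_mat c2 k"
  shows "four_block_mat A B C D * (P @\<^sub>r Q) = (A * P + B * Q) @\<^sub>r (C * P + D * Q)"
  unfolding append_rows_def
  by (subst mult_four_block_mat[of _ r1 c1 _ c2 _ r2 _ _ k _ 0]) (use assms in auto)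

text \<open>The recursion splits the rows and columns of a realization matrix as \<open>(p + 1) + m\<close>, the
  realization itself as \<open>p + (1 + m)\<close>; this lemma translates between the two partitions.\<close>

lemma four_block_regroup:
  assumes "D \<in> carrier_mat p p'" "u \<in> carrier_mat p k" "C \<in> carrier_mat p m'"
    "b \<in> carrier_mat l p'" "B \<in> carrier_mat m p'"
    "W \<in> carrier_mat l k" "a \<in> carrier_mat l m'" "Z \<in> carrier_mat m k" "A \<in> carrier_mat m m'"
  shows "four_block_mat D (u @\<^sub>c C) (b @\<^sub>r B) (four_block_mat W a Z A) =
    four_block_mat (four_block_mat D u b W) (C @\<^sub>r a) (B @\<^sub>c Z) A"
proof (rule eq_matI)
  fix i j assume "i < dim_row (four_block_mat (four_block_mat D u b W) (C @\<^sub>r a) (B @\<^sub>c Z) A)"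
    "j < dim_col (four_block_mat (four_block_mat D u b W) (C @\<^sub>r a) (B @\<^sub>c Z) A)"
  with assms have ij: "i < p + l + m" "j < p' + k + m'" by auto
  note d = assms[THEN carrier_matD(1)] assms[THEN carrier_matD(2)]
  have *: "\<not> i < p \<Longrightarrow> i - p < l \<longleftrightarrow> i < p + l" "i < p \<Longrightarrow> i < p + l" "\<not> i < p \<Longrightarrow> i - p < l + m"
    "\<not> j < p' \<Longrightarrow> j - p' < k \<longleftrightarrow> j < p' + k" "j < p' \<Longrightarrow> j < p' + k" "\<not> j < p' \<Longrightarrow> j - p' < k + m'"
    using ij by linarith+
  show "four_block_mat D (u @\<^sub>c C) (b @\<^sub>r B) (four_block_mat W a Z A) $$ (i, j) =
    four_block_mat (four_block_mat D u b W) (C @\<^sub>r a) (B @\<^sub>c Z) A $$ (i, j)"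
    using ij by (cases "i < p"; cases "i < p + l"; cases "j < p'"; cases "j < p' + k") (simp_all add: d *)
qed (use assms in auto)

lemma split_block_four_block:
  assumes "A \<in> carrier_mat r1 c1" "B \<in> carrier_mat r1 c2" "C \<in> carrier_mat r2 c1" "D \<in> carrier_mat r2 c2"
  shows "split_block (four_block_mat A B C D) r1 c1 = (A, B, C, D)"
  unfolding split_block_def Let_def using assms by (auto intro!: eq_matI)

lemma mat_inv_one [simp]: "mat_inv (1\<^sub>m n :: 'a :: field mat) = 1\<^sub>m n"
  by (rule mat_inv_eqI) auto

lemma mat_inv_smult_one:
  "c \<noteq> 0 \<Longrightarrow> mat_inv (c \<cdot>\<^sub>m 1\<^sub>m n :: 'a :: field mat) = inverse c \<cdot>\<^sub>m 1\<^sub>m n"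
  by (rule mat_inv_eqI[of _ n]) (auto simp: mult_smult_assoc_mat[of _ n n] intro!: eq_matI)

lemma smult_smult_mat: "c \<cdot>\<^sub>m (d \<cdot>\<^sub>m A) = (c * d :: 'a :: comm_ring_1) \<cdot>\<^sub>m A"
  by (rule eq_matI) (auto simp: mult.assoc)

lemma smult_one_mult:
  "A \<in> carrier_mat m n \<Longrightarrow> (c \<cdot>\<^sub>m 1\<^sub>m m) * A = (c :: 'a :: comm_ring_1) \<cdot>\<^sub>m A"
  "A \<in> carrier_mat m n \<Longrightarrow> A * (c \<cdot>\<^sub>m 1\<^sub>m n) = (c :: 'a :: comm_ring_1) \<cdot>\<^sub>m A"
  by (simp_all add: mult_smult_assoc_mat[of _ m m _ n] mult_smult_distrib[of _ m n _ n])

lemma one_smult [simp]: "(1 :: 'a :: comm_ring_1) \<cdot>\<^sub>m A = A"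
  by (rule eq_matI) auto

lemma uminus_zero_mat: "- 0\<^sub>m m n = (0\<^sub>m m n :: 'a :: comm_ring_1 mat)"
  by (rule eq_matI) auto

text \<open>Used to read an orthogonality relation of the unitary matrix as an equation for \<open>P\<close>.\<close>

lemma minus_eqI_mat:
  assumes "P + c \<cdot>\<^sub>m R = 0\<^sub>m r k" "P \<in> carrier_mat r k" "R \<in> carrier_mat r k"
  shows "P = (- c :: 'a :: comm_ring_1) \<cdot>\<^sub>m R"
proof (rule eq_matI)
  fix i j assume "i < dim_row (- c \<cdot>\<^sub>m R)" "j < dim_col (- c \<cdot>\<^sub>m R)"
  with arg_cong[OF assms(1), of "\<lambda>X. X $$ (i, j)"] assms(2,3)
  show "P $$ (i, j) = (- c \<cdot>\<^sub>m R) $$ (i, j)" by (simp add: add_eq_0_iff)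
qed (use assms(2,3) in auto)

section \<open>Evaluation of rational matrix functions\<close>

text \<open>\<open>rat_pole\<close> and \<open>rat_eval\<close> refer to the representation in lowest terms. A zero of the reduced
  denominator is a zero of every denominator, so any representation whose denominator does not
  vanish at \<open>z\<close> serves to evaluate there. All further rules for \<open>rat_eval\<close> rest on this.\<close>

lemma rat_eval_quotient:
  assumes "poly g z \<noteq> 0" and r: "r = to_fract f / to_fract g"
  shows "\<not> rat_pole r z" "rat_eval r z = poly f z / poly g z"
proof -
  obtain f' g' where fg: "quot_of_fract r = (f', g')" by (cases "quot_of_fract r")
  have g: "g \<noteq> 0" using assms by auto
  have cop: "coprime f' g'" and g': "g' \<noteq> 0"
    using coprime_quot_of_fract[of r] snd_quot_of_fract_nonzero[of r] fg by auto
  have "r = to_fract f' / to_fract g'"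
    using Fract_quot_of_fract[of r] fg by (simp add: Fract_conv_to_fract)
  with r g g' have "to_fract (f * g') = to_fract (f' * g)"
    by (simp add: field_simps)
  hence eq: "f * g' = f' * g" by (simp only: to_fract_eq_iff)
  hence "g' dvd f' * g" by (metis dvd_triv_right)
  with cop have "g' dvd g" by (metis coprime_commute coprime_dvd_mult_right_iff)
  with assms(1) have nz: "poly g' z \<noteq> 0" by auto
  have "poly f z * poly g' z = poly f' z * poly g z" using arg_cong[OF eq, of "\<lambda>q. poly q z"] by simp
  with nz assms(1) fg show "\<not> rat_pole r z" "rat_eval r z = poly f z / poly g z"
    by (simp_all add: rat_pole_def rat_eval_def field_simps)
qed

lemma rat_eval_regularE:
  assumes "\<not> rat_pole r z"
  obtains f g where "poly g z \<noteq> 0" "r = to_fract f / to_fract g" "rat_eval r z = poly f z / poly g z"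
proof (rule that)
  show "r = to_fract (fst (quot_of_fract r)) / to_fract (snd (quot_of_fract r))"
    using Fract_quot_of_fract[of r] by (simp add: Fract_conv_to_fract)
qed (use assms in \<open>simp_all add: rat_pole_def rat_eval_def\<close>)

lemma rat_eval_to_fract: "\<not> rat_pole (to_fract f) z" "rat_eval (to_fract f) z = poly f z"
  by (simp_all add: rat_pole_def rat_eval_def)

text \<open>The functions without pole at \<open>z\<close> form a ring on which evaluation is a homomorphism; for
  matrices this gives \<open>mat_eval_add\<close> and \<open>mat_eval_mult\<close>.\<close>

lemma rat_eval_add:
  assumes "\<not> rat_pole r z" "\<not> rat_pole s z"
  shows "\<not> rat_pole (r + s) z \<and> rat_eval (r + s) z = rat_eval r z + rat_eval s z"
proof -
  obtain f g where 1: "poly g z \<noteq> 0" "r = to_fract f / to_fract g" "rat_eval r z = poly f z / poly g z"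
    using assms by (elim rat_eval_regularE)
  obtain f' g' where 2: "poly g' z \<noteq> 0" "s = to_fract f' / to_fract g'" "rat_eval s z = poly f' z / poly g' z"
    using assms(2) by (elim rat_eval_regularE)
  have "g \<noteq> 0" "g' \<noteq> 0" using 1 2 by auto
  hence "r + s = to_fract (f * g' + f' * g) / to_fract (g * g')"
    using 1 2 by (simp add: field_simps)
  from rat_eval_quotient[OF _ this, of z] show ?thesis
    unfolding 1(3) 2(3) using 1(1) 2(1) by (simp add: add_frac_eq)
qed

lemma rat_eval_mult:
  assumes "\<not> rat_pole r z" "\<not> rat_pole s z"
  shows "\<not> rat_pole (r * s) z \<and> rat_eval (r * s) z = rat_eval r z * rat_eval s z"
proof -
  obtain f g where 1: "poly g z \<noteq> 0" "r = to_fract f / to_fract g" "rat_eval r z = poly f z / poly g z"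
    using assms by (elim rat_eval_regularE)
  obtain f' g' where 2: "poly g' z \<noteq> 0" "s = to_fract f' / to_fract g'" "rat_eval s z = poly f' z / poly g' z"
    using assms(2) by (elim rat_eval_regularE)
  have "r * s = to_fract (f * f') / to_fract (g * g')"
    using 1 2 by simp
  from rat_eval_quotient[OF _ this, of z] show ?thesis
    using 1 2 by simp
qed

lemma rat_eval_sum:
  assumes "\<And>i. i \<in> I \<Longrightarrow> \<not> rat_pole (f i) z"
  shows "\<not> rat_pole (sum f I) z \<and> rat_eval (sum f I) z = (\<Sum>i\<in>I. rat_eval (f i) z)"
  using assms
proof (induction I rule: infinite_finite_induct)
  case (insert i I)
  thus ?case using rat_eval_add[of "f i" z "sum f I"] by auto
qed (use rat_eval_to_fract[of 0 z] in auto)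

definition mat_regular :: "complex poly fract mat \<Rightarrow> complex \<Rightarrow> bool" where
  "mat_regular G z \<longleftrightarrow> (\<forall>i < dim_row G. \<forall>j < dim_col G. \<not> rat_pole (G $$ (i, j)) z)"

lemma mat_eval_carrier [simp]: "mat_eval G z \<in> carrier_mat m n \<longleftrightarrow> G \<in> carrier_mat m n"
  by (simp add: mat_eval_def)

lemma const_mat_carrier [simp]: "const_mat A \<in> carrier_mat m n \<longleftrightarrow> A \<in> carrier_mat m n"
  by (simp add: const_mat_def)

lemma mat_eval_add:
  assumes "M \<in> carrier_mat m n" "N \<in> carrier_mat m n" "mat_regular M z" "mat_regular N z"
  shows "mat_regular (M + N) z" "mat_eval (M + N) z = mat_eval M z + mat_eval N z"
  using assms rat_eval_add by (auto simp: mat_regular_def mat_eval_def intro!: eq_matI)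

lemma mat_eval_mult:
  assumes "M \<in> carrier_mat m n" "N \<in> carrier_mat n k" "mat_regular M z" "mat_regular N z"
  shows "mat_regular (M * N) z" "mat_eval (M * N) z = mat_eval M z * mat_eval N z"
proof -
  have *: "\<not> rat_pole ((M * N) $$ (i, j)) z \<and>
    rat_eval ((M * N) $$ (i, j)) z = (mat_eval M z * mat_eval N z) $$ (i, j)"
    if ij: "i < m" "j < k" for i j
  proof -
    have e: "(M * N) $$ (i, j) = (\<Sum>l\<in>{0..<n}. M $$ (i, l) * N $$ (l, j))"
      using ij assms by (simp add: scalar_prod_def)
    have t: "\<not> rat_pole (M $$ (i, l) * N $$ (l, j)) z \<and>
       rat_eval (M $$ (i, l) * N $$ (l, j)) z = mat_eval M z $$ (i, l) * mat_eval N z $$ (l, j)"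
      if "l < n" for l
      using that ij assms rat_eval_mult[of "M $$ (i, l)" z "N $$ (l, j)"]
      by (auto simp: mat_regular_def mat_eval_def)
    have "(mat_eval M z * mat_eval N z) $$ (i, j) =
      (\<Sum>l\<in>{0..<n}. mat_eval M z $$ (i, l) * mat_eval N z $$ (l, j))"
      using ij assms by (simp add: scalar_prod_def mat_eval_def)
    with rat_eval_sum[of "{0..<n}" "\<lambda>l. M $$ (i, l) * N $$ (l, j)" z] t
    show ?thesis unfolding e by auto
  qed
  show "mat_regular (M * N) z" using * assms by (auto simp: mat_regular_def)
  show "mat_eval (M * N) z = mat_eval M z * mat_eval N z"
    by (rule eq_matI) (use * assms in \<open>auto simp: mat_eval_def\<close>)
qed

lemma mat_eval_const_mat: "mat_regular (const_mat A) z" "mat_eval (const_mat A) z = A"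
  by (auto simp: mat_regular_def mat_eval_def const_mat_def rat_eval_to_fract intro!: eq_matI)

lemma to_fract_comm_ring_hom: "comm_ring_hom (to_fract :: 'a :: idom \<Rightarrow> 'a fract)"
  by unfold_locales simp_all

lemma const_comm_ring_hom: "comm_ring_hom (\<lambda>c :: complex. to_fract [:c:])"
proof
  show "to_fract [:1:] = (1 :: complex poly fract)" by (metis one_pCons to_fract_1)
  fix x y :: complex
  show "to_fract [:x + y:] = to_fract [:x:] + to_fract [:y:]" by (simp flip: to_fract_add)
  show "to_fract [:x * y:] = to_fract [:x:] * to_fract [:y:]"
    by (simp add: mult.commute flip: to_fract_mult)
qed simp

lemma const_mat_mult:
  "A \<in> carrier_mat m n \<Longrightarrow> B \<in> carrier_mat n k \<Longrightarrow> const_mat (A * B) = const_mat A * const_mat B"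
proof -
  interpret comm_ring_hom "\<lambda>c :: complex. to_fract [:c:]" by (rule const_comm_ring_hom)
  show "A \<in> carrier_mat m n \<Longrightarrow> B \<in> carrier_mat n k \<Longrightarrow> ?thesis"
    unfolding const_mat_def by (rule mat_hom_mult)
qed

lemma const_mat_add:
  "A \<in> carrier_mat m n \<Longrightarrow> B \<in> carrier_mat m n \<Longrightarrow> const_mat (A + B) = const_mat A + const_mat B"
  by (rule eq_matI) (auto simp: const_mat_def simp flip: to_fract_add)

lemma const_mat_smult: "const_mat (c \<cdot>\<^sub>m A) = to_fract [:c:] \<cdot>\<^sub>m const_mat A"
proof -
  interpret comm_ring_hom "\<lambda>c :: complex. to_fract [:c:]" by (rule const_comm_ring_hom)
  show ?thesis by (rule eq_matI) (simp_all only: const_mat_def hom_mult index_map_mat index_smult_mat)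
qed

lemma const_mat_zero [simp]: "const_mat (0\<^sub>m m n) = 0\<^sub>m m n"
  by (rule eq_matI) (simp_all add: const_mat_def)

lemma const_mat_one [simp]: "const_mat (1\<^sub>m n) = 1\<^sub>m n"
proof -
  interpret comm_ring_hom "\<lambda>c :: complex. to_fract [:c:]" by (rule const_comm_ring_hom)
  show ?thesis by (rule eq_matI) (auto simp: const_mat_def hom_one)
qed

lemma const_mat_four_block:
  assumes "A \<in> carrier_mat r1 c1" "B \<in> carrier_mat r1 c2"
    "C \<in> carrier_mat r2 c1" "D \<in> carrier_mat r2 c2"
  shows "const_mat (four_block_mat A B C D) =
    four_block_mat (const_mat A) (const_mat B) (const_mat C) (const_mat D)"
  unfolding const_mat_def by (rule map_four_block_mat[OF assms])

lemma const_mat_append_rows: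
  "A \<in> carrier_mat r1 c \<Longrightarrow> B \<in> carrier_mat r2 c \<Longrightarrow>
    const_mat (A @\<^sub>r B) = const_mat A @\<^sub>r const_mat B"
  and const_mat_append_cols:
  "A' \<in> carrier_mat r c1 \<Longrightarrow> B' \<in> carrier_mat r c2 \<Longrightarrow>
    const_mat (A' @\<^sub>c B') = const_mat A' @\<^sub>c const_mat B'"
  by (rule eq_matI; auto simp: const_mat_def)+

lemma
  assumes A: "A \<in> carrier_mat n n"
  shows resolvent_carrier: "resolvent A \<in> carrier_mat n n"
    and resolvent_right_inverse: "(var_z \<cdot>\<^sub>m 1\<^sub>m n - const_mat A) * resolvent A = 1\<^sub>m n"
    and resolvent_regular: "\<not> eigenvalue A z \<Longrightarrow> mat_regular (resolvent A) z"
proof -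
  interpret h: comm_ring_hom "to_fract :: complex poly \<Rightarrow> _" by (rule to_fract_comm_ring_hom)
  let ?P = "char_poly_matrix A"
  let ?Q = "var_z \<cdot>\<^sub>m 1\<^sub>m n - const_mat A"
  let ?X = "char_poly A"
  let ?S = "map_mat (\<lambda>q. to_fract q / to_fract ?X) (adj_mat ?P)"
  have P: "?P \<in> carrier_mat n n" using A by simp
  have X: "?X \<noteq> 0" using degree_monic_char_poly[OF A] by auto
  have Q: "?Q \<in> carrier_mat n n" by (rule minus_carrier_mat) (simp add: A)
  have PQ: "map_mat to_fract ?P = ?Q"
  proof (rule eq_matI)
    fix i j assume "i < dim_row ?Q" "j < dim_col ?Q"
    thus "map_mat to_fract ?P $$ (i, j) = ?Q $$ (i, j)"
      using A by (auto simp: char_poly_matrix_def const_mat_def var_z_def simp flip: to_fract_diff to_fract_uminus)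
  qed (use A in \<open>auto simp: char_poly_matrix_def const_mat_def\<close>)
  have Sc: "?S \<in> carrier_mat n n" using adj_mat[OF P] by simp
  have S: "?S = inverse (to_fract ?X) \<cdot>\<^sub>m map_mat to_fract (adj_mat ?P)"
    by (rule eq_matI) (auto simp: divide_inverse)
  have "?Q * ?S = inverse (to_fract ?X) \<cdot>\<^sub>m map_mat to_fract (?P * adj_mat ?P)"
    unfolding S PQ[symmetric] using P adj_mat[OF P]
    by (subst h.mat_hom_mult[OF P adj_mat(1)[OF P]]) (simp add: mult_smult_distrib[of _ n n _ n])
  also have "\<dots> = 1\<^sub>m n"
    unfolding adj_mat(2)[OF P] char_poly_def[symmetric]
    by (rule eq_matI) (use X in auto)
  finally have QS: "?Q * ?S = 1\<^sub>m n" .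
  have R: "resolvent A = ?S"
    unfolding resolvent_def using A mat_inv_eqI[OF Q Sc QS] by simp
  show "resolvent A \<in> carrier_mat n n" "?Q * resolvent A = 1\<^sub>m n"
    using R Sc QS by auto
  assume "\<not> eigenvalue A z"
  hence "poly ?X z \<noteq> 0" using eigenvalue_root_char_poly[OF A] by simp
  thus "mat_regular (resolvent A) z"
    unfolding R mat_regular_def using rat_eval_quotient(1) by auto
qed

lemma resolvent_eqI:
  assumes "A \<in> carrier_mat n n" "R \<in> carrier_mat n n"
    "(var_z \<cdot>\<^sub>m 1\<^sub>m n - const_mat A) * R = 1\<^sub>m n"
  shows "resolvent A = R"
  unfolding resolvent_def using assms by (intro mat_inv_eqI) auto

text \<open>Evaluation is multiplicative, so evaluating the identity \<open>(z - A) resolvent A = 1\<close> yields the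
  numerical inverse of \<open>z - A\<close>.\<close>

lemma resolvent_eval:
  assumes A: "A \<in> carrier_mat n n" and z: "\<not> eigenvalue A z"
  shows "(z \<cdot>\<^sub>m 1\<^sub>m n - A) * mat_eval (resolvent A) z = 1\<^sub>m n"
proof -
  let ?Q = "var_z \<cdot>\<^sub>m 1\<^sub>m n - const_mat A"
  have Q: "?Q = map_mat to_fract (char_poly_matrix A)"
    by (rule eq_matI) (use A in \<open>auto simp: char_poly_matrix_def const_mat_def var_z_def
        simp flip: to_fract_diff to_fract_uminus\<close>)
  have reg: "mat_regular ?Q z" unfolding Q by (auto simp: mat_regular_def rat_eval_to_fract)
  have ev: "mat_eval ?Q z = z \<cdot>\<^sub>m 1\<^sub>m n - A" unfolding Q
    by (rule eq_matI) (use A in \<open>auto simp: mat_eval_def rat_eval_to_fract char_poly_matrix_def\<close>)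
  have "mat_eval (?Q * resolvent A) z = mat_eval ?Q z * mat_eval (resolvent A) z"
    by (rule mat_eval_mult) (use A z reg in \<open>auto intro: resolvent_carrier resolvent_regular\<close>)
  moreover have "mat_eval (?Q * resolvent A) z = 1\<^sub>m n"
    unfolding resolvent_right_inverse[OF A] using mat_eval_const_mat(2)[of "1\<^sub>m n" z] by simp
  ultimately show ?thesis using ev by simp
qed

lemma mat_eval_realization:
  assumes "realization p n G A B C D" and z: "\<not> eigenvalue A z"
  shows "mat_regular G z" "mat_eval G z = D + C * mat_eval (resolvent A) z * B"
proof -
  from assms have c: "A \<in> carrier_mat n n" "B \<in> carrier_mat n p" "C \<in> carrier_mat p n"
    "D \<in> carrier_mat p p" and G: "G = const_mat D + const_mat C * resolvent A * const_mat B"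
    by (auto simp: realization_def)
  note R = resolvent_carrier[OF c(1)] resolvent_regular[OF c(1) z]
  have CR: "const_mat C * resolvent A \<in> carrier_mat p n" using c R by auto
  have 1: "mat_regular (const_mat C * resolvent A) z"
    "mat_eval (const_mat C * resolvent A) z = C * mat_eval (resolvent A) z"
    using mat_eval_mult[of "const_mat C" p n "resolvent A" n z] R c mat_eval_const_mat by auto
  have 2: "mat_regular (const_mat C * resolvent A * const_mat B) z"
    "mat_eval (const_mat C * resolvent A * const_mat B) z = C * mat_eval (resolvent A) z * B"
    using mat_eval_mult[OF CR, of "const_mat B" p z] 1 c mat_eval_const_mat by auto
  show "mat_regular G z" "mat_eval G z = D + C * mat_eval (resolvent A) z * B"
    unfolding G using mat_eval_add[of "const_mat D" p p "const_mat C * resolvent A * const_mat B" z]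
      2 c CR mat_eval_const_mat by auto
qed

section \<open>Unitary realizations are lossless\<close>

text \<open>A square isometry is unitary. The two off-diagonal blocks of \<open>M\<^sup>H M\<close> are adjoints of each other,
  so one of them suffices.\<close>

lemma unitary_if_isometric_blocks:
  assumes c: "A \<in> carrier_mat m m" "B \<in> carrier_mat m p" "C \<in> carrier_mat p m" "D \<in> carrier_mat p p"
    and DD: "D\<^sup>H * D + B\<^sup>H * B = 1\<^sub>m p" and DC: "D\<^sup>H * C + B\<^sup>H * A = 0\<^sub>m p m" and CC: "C\<^sup>H * C + A\<^sup>H * A = 1\<^sub>m m"
  shows "unitary_mat (p + m) (four_block_mat D C B A)"
proof -
  let ?M = "four_block_mat D C B A"
  have H: "A\<^sup>H \<in> carrier_mat m m" "B\<^sup>H \<in> carrier_mat p m" "C\<^sup>H \<in> carrier_mat m p" "D\<^sup>H \<in> carrier_mat p p"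
    using c by auto
  have M: "?M \<in> carrier_mat (p + m) (p + m)" by (rule four_block_carrier_mat[OF c(4,1)])
  hence MHc: "?M\<^sup>H \<in> carrier_mat (p + m) (p + m)" by (simp only: adjoint_carrier)
  have "(D\<^sup>H * C + B\<^sup>H * A)\<^sup>H = C\<^sup>H * D + A\<^sup>H * B"
    using adjoint_add[OF mult_carrier_mat[OF H(4) c(3)] mult_carrier_mat[OF H(2) c(1)]]
      adjoint_mult[OF H(4) c(3)] adjoint_mult[OF H(2) c(1)] by simp
  hence CD: "C\<^sup>H * D + A\<^sup>H * B = 0\<^sub>m m p" unfolding DC by simp
  have "?M\<^sup>H * ?M = four_block_mat (D\<^sup>H * D + B\<^sup>H * B) (D\<^sup>H * C + B\<^sup>H * A) (C\<^sup>H * D + A\<^sup>H * B) (C\<^sup>H * C + A\<^sup>H * A)"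
    unfolding adjoint_four_block[OF c(4,3,2,1)] by (rule mult_four_block_mat[OF H(4,2,3,1) c(4,3,2,1)])
  also have "\<dots> = 1\<^sub>m (p + m)" unfolding DD DC CD CC by (rule four_block_one_mat)
  finally have 1: "?M\<^sup>H * ?M = 1\<^sub>m (p + m)" .
  from mat_mult_left_right_inverse[OF MHc M 1] 1 M show ?thesis by (simp add: unitary_mat_def)
qed

lemma inner_adjoint:
  assumes "A \<in> carrier_mat m n" "x \<in> carrier_vec n" "y \<in> carrier_vec m"
  shows "(A *\<^sub>v x) \<bullet>c y = x \<bullet>c (A\<^sup>H *\<^sub>v y)"
proof -
  have "(A *\<^sub>v x) \<bullet>c y = (\<Sum>i\<in>{0..<m}. \<Sum>j\<in>{0..<n}. A $$ (i, j) * x $ j * cnj (y $ i))"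
    using assms by (auto simp: scalar_prod_def sum_distrib_right intro!: sum.cong)
  also have "\<dots> = (\<Sum>j\<in>{0..<n}. \<Sum>i\<in>{0..<m}. A $$ (i, j) * x $ j * cnj (y $ i))"
    by (rule sum.swap)
  also have "\<dots> = x \<bullet>c (A\<^sup>H *\<^sub>v y)"
    using assms by (auto simp: scalar_prod_def sum_distrib_left mult_ac intro!: sum.cong)
  finally show ?thesis .
qed

lemma inner_self: "(v :: complex vec) \<bullet>c v = of_real (\<Sum>i<dim_vec v. (cmod (v $ i))\<^sup>2)"
  by (auto simp: scalar_prod_def atLeast0LessThan complex_norm_square simp del: of_real_power)

lemma pos_semidef_gram:
  assumes N: "N \<in> carrier_mat n k" and c: "c \<ge> 0"
  shows "pos_semidef n (complex_of_real c \<cdot>\<^sub>m (N * N\<^sup>H))"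
proof -
  have "Re (((complex_of_real c \<cdot>\<^sub>m (N * N\<^sup>H)) *\<^sub>v v) \<bullet>c v) \<ge> 0" if v: "v \<in> carrier_vec n" for v
  proof -
    have Nv: "N\<^sup>H *\<^sub>v v \<in> carrier_vec k" using N v by auto
    have smult: "(k \<cdot>\<^sub>m M) *\<^sub>v v = k \<cdot>\<^sub>v (M *\<^sub>v v)" if "M \<in> carrier_mat n n" for k and M :: "complex mat"
      by (rule eq_vecI) (use that v in auto)
    have "((complex_of_real c \<cdot>\<^sub>m (N * N\<^sup>H)) *\<^sub>v v) = of_real c \<cdot>\<^sub>v (N *\<^sub>v (N\<^sup>H *\<^sub>v v))"
      using N v by (simp add: smult assoc_mult_mat_vec[of _ n k])
    hence "((complex_of_real c \<cdot>\<^sub>m (N * N\<^sup>H)) *\<^sub>v v) \<bullet>c v =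
      of_real c * ((N *\<^sub>v (N\<^sup>H *\<^sub>v v)) \<bullet>c v)"
      using N v by simp
    also have "\<dots> = of_real c * ((N\<^sup>H *\<^sub>v v) \<bullet>c (N\<^sup>H *\<^sub>v v))"
      using inner_adjoint[OF N Nv v] by simp
    finally show ?thesis using c by (simp add: inner_self sum_nonneg)
  qed
  moreover have "(N * N\<^sup>H)\<^sup>H = N * N\<^sup>H" using N by (simp add: adjoint_mult[of _ n k _ n])
  ultimately show ?thesis using N by (simp add: pos_semidef_def hermitian_def)
qed

text \<open>The diagonal entry \<open>(i, i)\<close> of \<open>1 - M M\<^sup>H\<close> is one minus the squared norm of the \<open>i\<close>-th row of \<open>M\<close>.\<close>

lemma contractive_entry_le_1:
  assumes M: "M \<in> carrier_mat p p" and psd: "pos_semidef p (1\<^sub>m p - M * M\<^sup>H)"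
    and ij: "i < p" "j < p"
  shows "cmod (M $$ (i, j)) \<le> 1"
proof -
  let ?X = "1\<^sub>m p - M * M\<^sup>H"
  have X: "?X \<in> carrier_mat p p" using psd by (simp add: pos_semidef_def hermitian_def)
  have "conjugate (unit_vec p i) = (unit_vec p i :: complex vec)"
    by (rule eq_vecI) (use ij in \<open>auto simp: unit_vec_def\<close>)
  hence "(?X *\<^sub>v unit_vec p i) \<bullet>c unit_vec p i = (?X *\<^sub>v unit_vec p i) $ i"
    using ij X by simp
  also have "\<dots> = ?X $$ (i, i)" using ij X by (subst index_mult_mat_vec) auto
  also have "\<dots> = 1 - (\<Sum>k\<in>{0..<p}. M $$ (i, k) * cnj (M $$ (i, k)))"
    using ij M by (auto simp: scalar_prod_def)
  also have "\<dots> = of_real (1 - (\<Sum>k\<in>{0..<p}. (cmod (M $$ (i, k)))\<^sup>2))"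
    by (simp add: complex_norm_square del: of_real_power)
  finally have "1 - (\<Sum>k\<in>{0..<p}. (cmod (M $$ (i, k)))\<^sup>2) \<ge> 0"
    using psd ij by (auto simp: pos_semidef_def dest!: bspec[of _ _ "unit_vec p i"])
  moreover have "(cmod (M $$ (i, j)))\<^sup>2 \<le> (\<Sum>k\<in>{0..<p}. (cmod (M $$ (i, k)))\<^sup>2)"
    using ij by (intro member_le_sum) auto
  ultimately have "(cmod (M $$ (i, j)))\<^sup>2 \<le> 1\<^sup>2" by simp
  thus ?thesis by (rule power2_le_imp_le) simp
qed

text \<open>For an eigenvector \<open>x\<close> the hypothesis gives
  \<open>|x|\<^sup>2 = |C x|\<^sup>2 + |A x|\<^sup>2 \<ge> |z|\<^sup>2 |x|\<^sup>2\<close>.\<close>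

lemma eigenvalue_contraction:
  assumes A: "A \<in> carrier_mat n n" and C: "C \<in> carrier_mat p n"
    and iso: "C\<^sup>H * C + A\<^sup>H * A = 1\<^sub>m n" and ev: "eigenvalue A z"
  shows "cmod z \<le> 1"
proof -
  obtain x where x: "x \<in> carrier_vec n" "x \<noteq> 0\<^sub>v n" "A *\<^sub>v x = z \<cdot>\<^sub>v x"
    using ev A by (auto simp: eigenvalue_def eigenvector_def)
  let ?N = "\<lambda>v :: complex vec. \<Sum>i<dim_vec v. (cmod (v $ i))\<^sup>2"
  have "x \<bullet>c x = x \<bullet>c ((C\<^sup>H * C + A\<^sup>H * A) *\<^sub>v x)" using iso x by simp
  also have "(C\<^sup>H * C + A\<^sup>H * A) *\<^sub>v x = C\<^sup>H *\<^sub>v (C *\<^sub>v x) + A\<^sup>H *\<^sub>v (A *\<^sub>v x)"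
    using A C x by (subst add_mult_distrib_mat_vec[of _ n n]) auto
  also have "x \<bullet>c \<dots> = x \<bullet>c (C\<^sup>H *\<^sub>v (C *\<^sub>v x)) + x \<bullet>c (A\<^sup>H *\<^sub>v (A *\<^sub>v x))"
    using A C x by (subst conjugate_add_vec[of _ n]) (auto simp: scalar_prod_add_distrib[of _ n])
  also have "\<dots> = (C *\<^sub>v x) \<bullet>c (C *\<^sub>v x) + (A *\<^sub>v x) \<bullet>c (A *\<^sub>v x)"
    using inner_adjoint[OF C x(1), of "C *\<^sub>v x"] inner_adjoint[OF A x(1), of "A *\<^sub>v x"] A C x by auto
  finally have "complex_of_real (?N x) = of_real (?N (C *\<^sub>v x) + ?N (z \<cdot>\<^sub>v x))"
    unfolding x(3) inner_self of_real_add .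
  hence "?N x = ?N (C *\<^sub>v x) + ?N (z \<cdot>\<^sub>v x)" by (rule of_real_eq_iff[THEN iffD1])
  moreover have "?N (z \<cdot>\<^sub>v x) = (cmod z)\<^sup>2 * ?N x"
    by (simp add: norm_mult power_mult_distrib sum_distrib_left)
  moreover have "?N (C *\<^sub>v x) \<ge> 0" by (rule sum_nonneg) simp
  ultimately have "(cmod z)\<^sup>2 * ?N x \<le> 1 * ?N x" by linarith
  moreover have "?N x > 0"
  proof -
    have "complex_of_real (?N x) \<noteq> 0"
      using conjugate_square_eq_0_vec[OF x(1)] x(2) unfolding inner_self by simp
    hence "?N x \<noteq> 0" by (simp only: of_real_eq_0_iff not_False_eq_True)
    moreover have "?N x \<ge> 0" by (rule sum_nonneg) simp
    ultimately show ?thesis by linarith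
  qed
  ultimately have "(cmod z)\<^sup>2 \<le> 1\<^sup>2" by simp
  thus ?thesis by (rule power2_le_imp_le) simp
qed

text \<open>With \<open>N = C S\<close>, \<open>Q = N A\<close> and \<open>E = N B\<close> the resolvent equation becomes \<open>C = z N - Q\<close>, and the
  hypotheses become \<open>D E\<^sup>H = - C Q\<^sup>H\<close> and \<open>E E\<^sup>H = N N\<^sup>H - Q Q\<^sup>H\<close>. Expanding the product gives
  \<open>(D + E) (D + E)\<^sup>H = 1 - (C + Q) (C + Q)\<^sup>H + N N\<^sup>H\<close>, where \<open>C + Q = z N\<close>.\<close>

lemma coisometric_defect:
  assumes c: "A \<in> carrier_mat n n" "B \<in> carrier_mat n p" "C \<in> carrier_mat p n" "D \<in> carrier_mat p p"
    and S: "S \<in> carrier_mat n n" "(z \<cdot>\<^sub>m 1\<^sub>m n - A) * S = 1\<^sub>m n"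
    and DD: "D * D\<^sup>H + C * C\<^sup>H = 1\<^sub>m p"
    and DB: "D * B\<^sup>H + C * A\<^sup>H = 0\<^sub>m p n"
    and BB: "B * B\<^sup>H + A * A\<^sup>H = 1\<^sub>m n"
  shows "1\<^sub>m p - (D + C * S * B) * (D + C * S * B)\<^sup>H =
    complex_of_real ((cmod z)\<^sup>2 - 1) \<cdot>\<^sub>m (C * S * (C * S)\<^sup>H)"
proof -
  define N Q E where "N = C * S" and "Q = N * A" and "E = N * B"
  have N: "N \<in> carrier_mat p n" and Q: "Q \<in> carrier_mat p n" and E: "E \<in> carrier_mat p p"
    using c S by (auto simp: N_def Q_def E_def)
  have zA: "z \<cdot>\<^sub>m 1\<^sub>m n - A \<in> carrier_mat n n" by (rule minus_carrier_mat[OF c(1)])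
  have "C = C * (S * (z \<cdot>\<^sub>m 1\<^sub>m n - A))"
    using mat_mult_left_right_inverse[OF zA S] c by simp
  also have "\<dots> = N * (z \<cdot>\<^sub>m 1\<^sub>m n - A)"
    unfolding N_def by (rule assoc_mult_mat[symmetric, OF c(3) S(1) zA])
  also have "\<dots> = z \<cdot>\<^sub>m N - Q"
    unfolding Q_def using N c by (simp add: mult_minus_distrib_mat[of _ p n _ n] mult_smult_distrib[of _ p n _ n])
  finally have C: "C = z \<cdot>\<^sub>m N - Q" .
  have EH: "E\<^sup>H = B\<^sup>H * N\<^sup>H" and QH: "Q\<^sup>H = A\<^sup>H * N\<^sup>H"
    unfolding E_def Q_def using N c by (simp_all add: adjoint_mult[of _ p n _ p] adjoint_mult[of _ p n _ n])
  have DE: "D * E\<^sup>H + C * Q\<^sup>H = 0\<^sub>m p p"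
  proof -
    have "D * E\<^sup>H + C * Q\<^sup>H = (D * B\<^sup>H + C * A\<^sup>H) * N\<^sup>H"
      unfolding EH QH using c N
      by (simp add: add_mult_distrib_mat[of _ p n _ _ p] assoc_mult_mat[of _ p p _ n _ p] assoc_mult_mat[of _ p n _ n _ p])
    thus ?thesis using DB N by simp
  qed
  have EE: "E * E\<^sup>H + Q * Q\<^sup>H = N * N\<^sup>H"
  proof -
    have "E * E\<^sup>H + Q * Q\<^sup>H = N * (B * B\<^sup>H + A * A\<^sup>H) * N\<^sup>H"
      unfolding EH QH unfolding E_def Q_def using c N
      by (simp add: add_mult_distrib_mat[of _ p n _ _ p] mult_add_distrib_mat[of _ p n _ n]
          assoc_mult_mat[of _ p n _ p _ p] assoc_mult_mat[of _ p n _ n _ p]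
          assoc_mult_mat[of _ n p _ n _ p] assoc_mult_mat[of _ n n _ n _ p])
    thus ?thesis using BB N by simp
  qed
  have ED: "E * D\<^sup>H + Q * C\<^sup>H = 0\<^sub>m p p"
    using arg_cong[OF DE, of mat_adjoint] c E Q
    by (simp add: adjoint_add[of _ p p] adjoint_mult[of _ p p _ p] adjoint_mult[of _ p n _ p])
  have GG: "(D + E) * (D + E)\<^sup>H = D * D\<^sup>H + E * D\<^sup>H + (D * E\<^sup>H + E * E\<^sup>H)"
    using c E by (simp add: adjoint_add[of _ p p] add_mult_distrib_mat[of _ p p _ _ p] mult_add_distrib_mat[of _ p p _ p])
  have CH: "C\<^sup>H = cnj z \<cdot>\<^sub>m N\<^sup>H - Q\<^sup>H"
    unfolding C using N Q by (simp add: adjoint_minus[of _ p n])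
  have CQ: "C * Q\<^sup>H = z \<cdot>\<^sub>m (N * Q\<^sup>H) - Q * Q\<^sup>H"
    unfolding C using N Q by (simp add: minus_mult_distrib_mat[of _ p n _ _ p] mult_smult_assoc_mat[of _ p n _ p])
  have QC: "Q * C\<^sup>H = cnj z \<cdot>\<^sub>m (Q * N\<^sup>H) - Q * Q\<^sup>H"
    unfolding CH using N Q by (simp add: mult_minus_distrib_mat[of _ p n _ p] mult_smult_distrib[of _ p n _ p])
  have CN: "C * N\<^sup>H = z \<cdot>\<^sub>m (N * N\<^sup>H) - Q * N\<^sup>H"
    unfolding C using N Q by (simp add: minus_mult_distrib_mat[of _ p n _ _ p] mult_smult_assoc_mat[of _ p n _ p])
  have CC: "C * C\<^sup>H = cnj z \<cdot>\<^sub>m (C * N\<^sup>H) - C * Q\<^sup>H"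
    unfolding CH using N Q c by (simp add: mult_minus_distrib_mat[of _ p n _ p] mult_smult_distrib[of _ p n _ p])
  \<comment> \<open>By the relations above the identity is linear in the four products of \<open>N\<close> and \<open>Q\<close> with \<open>N\<^sup>H\<close> and \<open>Q\<^sup>H\<close>;
    as variables \<open>NN\<close>, \<open>NQ\<close>, \<open>QN\<close>, \<open>QQ\<close> they can be compared entry by entry.\<close>
  have entry: "1\<^sub>m p - (X1 + X3 + (X2 + X4)) = complex_of_real ((cmod z)\<^sup>2 - 1) \<cdot>\<^sub>m NN"
    if "X1 + (cnj z \<cdot>\<^sub>m (z \<cdot>\<^sub>m NN - QN) - (z \<cdot>\<^sub>m NQ - QQ)) = 1\<^sub>m p"
      "X2 + (z \<cdot>\<^sub>m NQ - QQ) = 0\<^sub>m p p" "X3 + (cnj z \<cdot>\<^sub>m QN - QQ) = 0\<^sub>m p p"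
      "X4 + QQ = NN"
      and d: "X1 \<in> carrier_mat p p" "X2 \<in> carrier_mat p p" "X3 \<in> carrier_mat p p" "X4 \<in> carrier_mat p p"
        "NN \<in> carrier_mat p p" "NQ \<in> carrier_mat p p" "QN \<in> carrier_mat p p" "QQ \<in> carrier_mat p p"
    for X1 X2 X3 X4 NN NQ QN QQ :: "complex mat"
  proof (rule eq_matI)
    fix i j assume "i < dim_row (complex_of_real ((cmod z)\<^sup>2 - 1) \<cdot>\<^sub>m NN)"
      "j < dim_col (complex_of_real ((cmod z)\<^sup>2 - 1) \<cdot>\<^sub>m NN)"
    hence ij: "i < p" "j < p" using d by auto
    have z2: "complex_of_real ((cmod z)\<^sup>2) = z * cnj z" by (rule complex_norm_square)
    have X: "X1 $$ (i, j) = 1\<^sub>m p $$ (i, j) - (cnj z * (z * NN $$ (i, j) - QN $$ (i, j)) - (z * NQ $$ (i, j) - QQ $$ (i, j)))"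
      "X2 $$ (i, j) = - (z * NQ $$ (i, j) - QQ $$ (i, j))"
      "X3 $$ (i, j) = - (cnj z * QN $$ (i, j) - QQ $$ (i, j))"
      "X4 $$ (i, j) = NN $$ (i, j) - QQ $$ (i, j)"
      unfolding eq_diff_eq eq_neg_iff_add_eq_0
      using that(1-4)[THEN arg_cong, of "\<lambda>X. X $$ (i, j)"] d ij by auto
    have "1\<^sub>m p $$ (i, j) - (X1 $$ (i, j) + X3 $$ (i, j) + (X2 $$ (i, j) + X4 $$ (i, j))) =
      (z * cnj z - 1) * NN $$ (i, j)"
      unfolding X by (simp add: algebra_simps)
    thus "(1\<^sub>m p - (X1 + X3 + (X2 + X4))) $$ (i, j) =
      (complex_of_real ((cmod z)\<^sup>2 - 1) \<cdot>\<^sub>m NN) $$ (i, j)"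
      using d ij by (cases "i = j") (auto simp: z2 algebra_simps simp del: of_real_power)
  qed (use d in auto)
  show ?thesis
    unfolding N_def[symmetric] E_def[symmetric] GG
    by (rule entry[OF DD[unfolded CC CN CQ] DE[unfolded CQ] ED[unfolded QC] EE])
      (use c N Q E in auto)
qed

text \<open>If \<open>r = f / g\<close> in lowest terms, the bound gives \<open>|f| \<le> |g|\<close> along the sequence and so in the
  limit; a zero of \<open>g\<close> at \<open>z\<close> would be a common zero of \<open>f\<close> and \<open>g\<close>.\<close>

lemma no_pole_if_bounded_along:
  assumes s: "s \<longlonglongrightarrow> z"
    and "\<And>k. \<not> rat_pole r (s k)" "\<And>k. cmod (rat_eval r (s k)) \<le> 1"
  shows "\<not> rat_pole r z"
proof
  assume pole: "rat_pole r z"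
  obtain f g where fg: "quot_of_fract r = (f, g)" by (cases "quot_of_fract r")
  have lim: "(\<lambda>k. poly h (s k)) \<longlonglongrightarrow> poly h z" for h
    using isCont_tendsto_compose[OF _ s, of "poly h"] by simp
  have "cmod (poly f (s k)) \<le> cmod (poly g (s k))" for k
    using assms(2,3)[of k] fg by (simp add: rat_pole_def rat_eval_def norm_divide divide_le_eq)
  hence "cmod (poly f z) \<le> cmod (poly g z)"
    by (intro LIMSEQ_le[OF tendsto_norm[OF lim] tendsto_norm[OF lim]]) auto
  with pole fg have "poly f z = 0" "poly g z = 0" by (auto simp: rat_pole_def)
  moreover have "coprime f g" using coprime_quot_of_fract[of r] fg by simp
  ultimately show False using coprime_poly_0[of f g z] by auto
qed

lemma rat_eval_tendsto:
  assumes "\<not> rat_pole r z" and s: "s \<longlonglongrightarrow> z"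
  shows "(\<lambda>k. rat_eval r (s k)) \<longlonglongrightarrow> rat_eval r z"
proof -
  have lim: "(\<lambda>k. poly h (s k)) \<longlonglongrightarrow> poly h z" for h
    using isCont_tendsto_compose[OF _ s, of "poly h"] by simp
  show ?thesis unfolding rat_eval_def
    by (rule tendsto_divide[OF lim lim]) (use assms(1) in \<open>simp add: rat_pole_def\<close>)
qed

text \<open>Outside the closed disc \<open>A\<close> has no eigenvalue, and \<open>coisometric_defect\<close> shows that \<open>G\<close> is
  regular and contractive there. A point of the circle may be an eigenvalue of \<open>A\<close>. It is not a
  pole, because it is a radial limit of points at which the entries are bounded by one; and
  \<open>G G\<^sup>H = 1\<close> extends to it by continuity along the circle, on which only finitely many points are
  eigenvalues.\<close>

lemma lossless_if_unitary_realization: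
  assumes G: "realization p n G A B C D"
    and U: "unitary_mat (p + n) (four_block_mat D C B A)"
  shows "lossless p G"
proof -
  from G have c: "A \<in> carrier_mat n n" "B \<in> carrier_mat n p" "C \<in> carrier_mat p n"
    "D \<in> carrier_mat p p" and "G = const_mat D + const_mat C * resolvent A * const_mat B"
    by (auto simp: realization_def)
  hence Gc: "G \<in> carrier_mat p p" using resolvent_carrier[OF c(1)] by auto
  let ?M = "four_block_mat D C B A"
  have MH: "?M\<^sup>H = four_block_mat (D\<^sup>H) (B\<^sup>H) (C\<^sup>H) (A\<^sup>H)"
    by (rule adjoint_four_block[OF c(4,3,2,1)])
  have cH: "A\<^sup>H \<in> carrier_mat n n" "B\<^sup>H \<in> carrier_mat p n" "C\<^sup>H \<in> carrier_mat n p"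
    "D\<^sup>H \<in> carrier_mat p p" using c by auto
  have "four_block_mat (D * D\<^sup>H + C * C\<^sup>H) (D * B\<^sup>H + C * A\<^sup>H) (B * D\<^sup>H + A * C\<^sup>H) (B * B\<^sup>H + A * A\<^sup>H)
    = ?M * ?M\<^sup>H"
    unfolding MH by (rule mult_four_block_mat[symmetric]) (use c cH in auto)
  also have "\<dots> = four_block_mat (1\<^sub>m p) (0\<^sub>m p n) (0\<^sub>m n p) (1\<^sub>m n)"
    using U by (simp add: unitary_mat_def)
  finally have row: "D * D\<^sup>H + C * C\<^sup>H = 1\<^sub>m p" "D * B\<^sup>H + C * A\<^sup>H = 0\<^sub>m p n"
    "B * B\<^sup>H + A * A\<^sup>H = 1\<^sub>m n"
    by (subst (asm) four_block_eq_iff[of _ p p _ n _ n]; use c cH in auto)+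
  have "four_block_mat (D\<^sup>H * D + B\<^sup>H * B) (D\<^sup>H * C + B\<^sup>H * A) (C\<^sup>H * D + A\<^sup>H * B) (C\<^sup>H * C + A\<^sup>H * A)
    = ?M\<^sup>H * ?M"
    unfolding MH by (rule mult_four_block_mat[symmetric]) (use c cH in auto)
  also have "\<dots> = four_block_mat (1\<^sub>m p) (0\<^sub>m p n) (0\<^sub>m n p) (1\<^sub>m n)"
    using U by (simp add: unitary_mat_def)
  finally have iso: "C\<^sup>H * C + A\<^sup>H * A = 1\<^sub>m n"
    by (subst (asm) four_block_eq_iff[of _ p p _ n _ n]; use c cH in auto)
  have defect: "1\<^sub>m p - mat_eval G z * (mat_eval G z)\<^sup>H = complex_of_real ((cmod z)\<^sup>2 - 1) \<cdot>\<^sub>m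
      (C * mat_eval (resolvent A) z * (C * mat_eval (resolvent A) z)\<^sup>H)"
    if "\<not> eigenvalue A z" for z
    unfolding mat_eval_realization(2)[OF G that]
    by (rule coisometric_defect[OF c _ _ row])
      (use resolvent_carrier[OF c(1)] resolvent_eval[OF c(1) that] in auto)
  have CS: "C * mat_eval (resolvent A) z \<in> carrier_mat p n" for z
    using c(3) resolvent_carrier[OF c(1)] by auto
  have out: "\<not> eigenvalue A z" if "cmod z > 1" for z
    using eigenvalue_contraction[OF c(1,3) iso, of z] that by auto
  have psd: "pos_semidef p (1\<^sub>m p - mat_eval G z * (mat_eval G z)\<^sup>H)" if "cmod z > 1" for z
  proof -
    have "(cmod z)\<^sup>2 - 1 \<ge> 0" using that by (simp add: one_le_power)
    from pos_semidef_gram[OF CS this] show ?thesis unfolding defect[OF out[OF that]] .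
  qed
  have reg: "\<not> rat_pole (G $$ (i, j)) z" if "cmod z \<ge> 1" and ij: "i < p" "j < p" for z i j
  proof (cases "cmod z > 1")
    case True
    from mat_eval_realization(1)[OF G out[OF True]] ij Gc show ?thesis by (simp add: mat_regular_def)
  next
    case False
    \<comment> \<open>Approach the point of the circle along its ray, from outside the disc.\<close>
    define s where "s k = z * of_real (1 + inverse (real (Suc k)))" for k
    have "s \<longlonglongrightarrow> z * of_real (1 + 0)"
      unfolding s_def by (intro tendsto_intros LIMSEQ_inverse_real_of_nat)
    hence s: "s \<longlonglongrightarrow> z" by simp
    have s1: "cmod (s k) > 1" for k
    proof -
      have "cmod (s k) = 1 + inverse (real (Suc k))"
        unfolding s_def norm_mult norm_of_real using that(1) False by simp
      thus ?thesis by simp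
    qed
    show ?thesis
    proof (rule no_pole_if_bounded_along[OF s])
      fix k
      show "\<not> rat_pole (G $$ (i, j)) (s k)"
        using mat_eval_realization(1)[OF G out[OF s1]] ij Gc by (simp add: mat_regular_def)
      show "cmod (rat_eval (G $$ (i, j)) (s k)) \<le> 1"
        using contractive_entry_le_1[OF _ psd[OF s1[of k]] ij] Gc ij by (simp add: mat_eval_def)
    qed
  qed
  have eq: "mat_eval G z * (mat_eval G z)\<^sup>H = 1\<^sub>m p" if z: "cmod z = 1" for z
  proof -
    \<comment> \<open>Approach the point along the circle without ever meeting it, so that eigenvalues are avoided
      eventually even if the point is one itself.\<close>
    define s where "s k = z * cis (inverse (real (Suc k)))" for k
    have "s \<longlonglongrightarrow> z * cis 0"
      unfolding s_def cis_conv_exp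
      by (intro tendsto_intros tendsto_exp tendsto_of_real LIMSEQ_inverse_real_of_nat)
    hence s: "s \<longlonglongrightarrow> z" by simp
    have s1: "cmod (s k) = 1" for k using z by (simp add: s_def norm_mult)
    have sz: "s k \<noteq> z" for k
    proof
      assume "s k = z"
      hence "cis (inverse (real (Suc k))) = 1" using z by (auto simp: s_def)
      hence "sin (inverse (real (Suc k))) = 0" by (metis cis.sel(2) one_complex.sel(2))
      moreover have "inverse (real (Suc k)) \<le> 1" by (simp add: inverse_le_1_iff)
      hence "inverse (real (Suc k)) < pi" using pi_ge_two by linarith
      hence "sin (inverse (real (Suc k))) > 0" by (intro sin_gt_zero) auto
      ultimately show False by simp
    qed
    have X: "char_poly A \<noteq> 0" using degree_monic_char_poly[OF c(1)] by auto
    have "finite {x. poly (char_poly A) x = 0}" by (rule poly_roots_finite[OF X])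
    hence "\<forall>\<^sub>F k in sequentially. \<forall>x \<in> {x. poly (char_poly A) x = 0}. s k \<noteq> x"
    proof (rule eventually_ball_finite, intro ballI)
      fix x
      show "\<forall>\<^sub>F k in sequentially. s k \<noteq> x"
        using sz tendsto_imp_eventually_ne[OF s, of x] by (cases "x = z") auto
    qed
    hence ev: "\<forall>\<^sub>F k in sequentially. mat_eval G (s k) * (mat_eval G (s k))\<^sup>H = 1\<^sub>m p"
    proof (rule eventually_mono)
      fix k assume "\<forall>x \<in> {x. poly (char_poly A) x = 0}. s k \<noteq> x"
      hence "\<not> eigenvalue A (s k)" using eigenvalue_root_char_poly[OF c(1)] by auto
      from defect[OF this] s1
      have d: "1\<^sub>m p - mat_eval G (s k) * (mat_eval G (s k))\<^sup>H = 0 \<cdot>\<^sub>m (C * mat_eval (resolvent A) (s k) * (C * mat_eval (resolvent A) (s k))\<^sup>H)"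
        by simp
      have zero: "X = 1\<^sub>m p" if "1\<^sub>m p - X = 0 \<cdot>\<^sub>m Y" "X \<in> carrier_mat p p" "Y \<in> carrier_mat p p"
        for X Y :: "complex mat"
      proof (rule eq_matI)
        fix i j assume "i < dim_row (1\<^sub>m p)" "j < dim_col (1\<^sub>m p)"
        with arg_cong[OF that(1), of "\<lambda>X. X $$ (i, j)"] that(2,3)
        show "X $$ (i, j) = 1\<^sub>m p $$ (i, j)" by simp
      qed (use that in auto)
      show "mat_eval G (s k) * (mat_eval G (s k))\<^sup>H = 1\<^sub>m p"
        by (rule zero[OF d]) (use Gc CS[of "s k"] in \<open>auto intro!: mult_carrier_mat[of _ p n]\<close>)
    qed
    show ?thesis
    proof (rule eq_matI)
      fix i j assume "i < dim_row (1\<^sub>m p)" "j < dim_col (1\<^sub>m p)"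
      hence ij: "i < p" "j < p" by auto
      have entry: "(mat_eval G y * (mat_eval G y)\<^sup>H) $$ (i, j) =
        (\<Sum>l\<in>{0..<p}. rat_eval (G $$ (i, l)) y * cnj (rat_eval (G $$ (j, l)) y))" for y
        using ij Gc by (simp add: scalar_prod_def mat_eval_def)
      have "(\<lambda>k. (mat_eval G (s k) * (mat_eval G (s k))\<^sup>H) $$ (i, j))
        \<longlonglongrightarrow> (mat_eval G z * (mat_eval G z)\<^sup>H) $$ (i, j)"
        unfolding entry by (intro tendsto_intros rat_eval_tendsto[OF _ s] reg) (use ij z in auto)
      moreover have "(\<lambda>k. (mat_eval G (s k) * (mat_eval G (s k))\<^sup>H) $$ (i, j)) \<longlonglongrightarrow> 1\<^sub>m p $$ (i, j)"
        by (rule tendsto_eventually, rule eventually_mono[OF ev]) simp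
      ultimately show "(mat_eval G z * (mat_eval G z)\<^sup>H) $$ (i, j) = 1\<^sub>m p $$ (i, j)"
        by (rule LIMSEQ_unique)
    qed (use Gc in \<open>auto simp: mat_eval_def\<close>)
  qed
  show ?thesis unfolding lossless_def using Gc reg psd eq by blast
qed

section \<open>Transfer functions of block triangular realizations\<close>

text \<open>The index \<open>1\<close> in the dimensions of columns and rows has to survive simplification, so that
  carrier facts keep matching.\<close>

declare One_nat_def [simp del]

text \<open>Block back substitution for \<open>(z - w, - a; 0, z - A)\<close>.\<close>

lemma resolvent_block_triangular:
  fixes w :: complex
  assumes A: "A \<in> carrier_mat m m" and a: "a \<in> carrier_mat 1 m"
  defines "r \<equiv> inverse (var_z - to_fract [:w:])" and "R \<equiv> resolvent A"
  shows "resolvent (four_block_mat (w \<cdot>\<^sub>m 1\<^sub>m 1) a (0\<^sub>m m 1) A) =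
    four_block_mat (r \<cdot>\<^sub>m 1\<^sub>m 1) (r \<cdot>\<^sub>m (const_mat a * R)) (0\<^sub>m m 1) R"
proof (rule resolvent_eqI)
  have R: "R \<in> carrier_mat m m" "(var_z \<cdot>\<^sub>m 1\<^sub>m m - const_mat A) * R = 1\<^sub>m m"
    using resolvent_carrier[OF A] resolvent_right_inverse[OF A] by (simp_all add: R_def)
  have aR: "const_mat a * R \<in> carrier_mat 1 m" using a R by auto
  have Q: "var_z \<cdot>\<^sub>m 1\<^sub>m m - const_mat A \<in> carrier_mat m m" by (rule minus_carrier_mat) (simp add: A)
  show "four_block_mat (w \<cdot>\<^sub>m 1\<^sub>m 1) a (0\<^sub>m m 1) A \<in> carrier_mat (1 + m) (1 + m)"
    using A by (intro four_block_carrier_mat) auto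
  show "four_block_mat (r \<cdot>\<^sub>m 1\<^sub>m 1) (r \<cdot>\<^sub>m (const_mat a * R)) (0\<^sub>m m 1) R \<in> carrier_mat (1 + m) (1 + m)"
    using R by (intro four_block_carrier_mat) auto
  have "var_z - to_fract [:w:] \<noteq> 0" unfolding var_z_def to_fract_diff[symmetric] by simp
  hence r: "(var_z - to_fract [:w:]) * r = 1" by (simp add: r_def)
  have "const_mat (four_block_mat (w \<cdot>\<^sub>m 1\<^sub>m 1) a (0\<^sub>m m 1) A) =
    four_block_mat (to_fract [:w:] \<cdot>\<^sub>m 1\<^sub>m 1) (const_mat a) (0\<^sub>m m 1) (const_mat A)"
    by (subst const_mat_four_block[of _ 1 1 _ m _ m]) (use a A in \<open>auto simp: const_mat_smult\<close>)
  hence block: "var_z \<cdot>\<^sub>m 1\<^sub>m (1 + m) - const_mat (four_block_mat (w \<cdot>\<^sub>m 1\<^sub>m 1) a (0\<^sub>m m 1) A) =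
    four_block_mat ((var_z - to_fract [:w:]) \<cdot>\<^sub>m 1\<^sub>m 1) (- const_mat a) (0\<^sub>m m 1) (var_z \<cdot>\<^sub>m 1\<^sub>m m - const_mat A)"
  proof -
    have "var_z \<cdot>\<^sub>m 1\<^sub>m (1 + m) - four_block_mat (c \<cdot>\<^sub>m 1\<^sub>m 1) a' (0\<^sub>m m 1) A' =
      four_block_mat ((var_z - c) \<cdot>\<^sub>m 1\<^sub>m 1) (- a') (0\<^sub>m m 1) (var_z \<cdot>\<^sub>m 1\<^sub>m m - A')"
      if "a' \<in> carrier_mat 1 m" "A' \<in> carrier_mat m m" for a' A' c
      by (rule eq_matI) (use that in auto)
    from this[of "const_mat a" "const_mat A" "to_fract [:w:]"] a A
    show ?thesis unfolding \<open>const_mat (four_block_mat _ _ _ _) = _\<close> by simp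
  qed
  have "(var_z - to_fract [:w:]) \<cdot>\<^sub>m 1\<^sub>m 1 * (r \<cdot>\<^sub>m (const_mat a * R)) + - const_mat a * R = 0\<^sub>m 1 m"
  proof -
    have "X + - X = 0\<^sub>m 1 m" if "X \<in> carrier_mat 1 m" for X :: "complex poly fract mat"
      by (rule eq_matI) (use that in auto)
    from this[OF aR] show ?thesis using a R(1) aR
      by (simp add: smult_one_mult[of _ 1 m] smult_smult_mat r uminus_mult_left_mat)
  qed
  thus "(var_z \<cdot>\<^sub>m 1\<^sub>m (1 + m) - const_mat (four_block_mat (w \<cdot>\<^sub>m 1\<^sub>m 1) a (0\<^sub>m m 1) A)) *
    four_block_mat (r \<cdot>\<^sub>m 1\<^sub>m 1) (r \<cdot>\<^sub>m (const_mat a * R)) (0\<^sub>m m 1) R = 1\<^sub>m (1 + m)"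
    unfolding block using a R Q
    by (subst mult_four_block_mat[of _ 1 1 _ m _ m _ _ 1 _ m])
      (auto simp: smult_one_mult[of _ 1 1] smult_smult_mat r mult.commute[of r] right_mult_zero_mat[OF Q])
qed

text \<open>Only the part \<open>u\<close> of the output that sees the first state meets the pole at \<open>w\<close>. For
  \<open>u = 0\<close> the first state disappears from the transfer function.\<close>

lemma transfer_function_block_triangular:
  assumes A: "A \<in> carrier_mat m m" and B: "B \<in> carrier_mat m p" and C: "C \<in> carrier_mat p m"
    and a: "a \<in> carrier_mat 1 m" and b: "b \<in> carrier_mat 1 p" and u: "u \<in> carrier_mat p 1"
  shows "const_mat (u @\<^sub>c C) * resolvent (four_block_mat (w \<cdot>\<^sub>m 1\<^sub>m 1) a (0\<^sub>m m 1) A) * const_mat (b @\<^sub>r B) =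
    const_mat C * resolvent A * const_mat B + inverse (var_z - to_fract [:w:]) \<cdot>\<^sub>m
      (const_mat u * (const_mat b + const_mat a * resolvent A * const_mat B))"
proof -
  let ?r = "inverse (var_z - to_fract [:w:])" and ?R = "resolvent A"
  let ?A = "const_mat A" and ?B = "const_mat B" and ?C = "const_mat C"
    and ?a = "const_mat a" and ?b = "const_mat b" and ?u = "const_mat u"
  have c: "?B \<in> carrier_mat m p" "?C \<in> carrier_mat p m" "?a \<in> carrier_mat 1 m" "?b \<in> carrier_mat 1 p"
    "?u \<in> carrier_mat p 1" "?R \<in> carrier_mat m m"
    using assms resolvent_carrier[OF A] by auto
  have aR: "?a * ?R \<in> carrier_mat 1 m" and CR: "?C * ?R \<in> carrier_mat p m"
    and aRB: "?a * ?R * ?B \<in> carrier_mat 1 p"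
    and CRB: "?C * ?R * ?B \<in> carrier_mat p p" and ub: "?u * ?b \<in> carrier_mat p p"
    using c by auto
  have uaR: "?u * (?a * ?R) \<in> carrier_mat p m" and uaRB: "?u * (?a * ?R * ?B) \<in> carrier_mat p p"
    using c(5) aR aRB by auto
  have col: "const_mat (u @\<^sub>c C) = ?u @\<^sub>c ?C" and row: "const_mat (b @\<^sub>r B) = ?b @\<^sub>r ?B"
    using const_mat_append_cols[OF u C] const_mat_append_rows[OF b B] .
  have "(?u @\<^sub>c ?C) * four_block_mat (?r \<cdot>\<^sub>m 1\<^sub>m 1) (?r \<cdot>\<^sub>m (?a * ?R)) (0\<^sub>m m 1) ?R =
    (?u * (?r \<cdot>\<^sub>m 1\<^sub>m 1) + ?C * 0\<^sub>m m 1) @\<^sub>c (?u * (?r \<cdot>\<^sub>m (?a * ?R)) + ?C * ?R)"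
    by (rule append_cols_mult_four_block) (use c aR in auto)
  also have "\<dots> = (?r \<cdot>\<^sub>m ?u) @\<^sub>c (?r \<cdot>\<^sub>m (?u * (?a * ?R)) + ?C * ?R)"
    using c by (simp add: smult_one_mult(2)[OF c(5)] mult_smult_distrib[OF c(5) aR])
  finally have 1: "const_mat (u @\<^sub>c C) * resolvent (four_block_mat (w \<cdot>\<^sub>m 1\<^sub>m 1) a (0\<^sub>m m 1) A) =
    (?r \<cdot>\<^sub>m ?u) @\<^sub>c (?r \<cdot>\<^sub>m (?u * (?a * ?R)) + ?C * ?R)"
    unfolding col resolvent_block_triangular[OF A a] .
  have "((?r \<cdot>\<^sub>m ?u) @\<^sub>c (?r \<cdot>\<^sub>m (?u * (?a * ?R)) + ?C * ?R)) * (?b @\<^sub>r ?B) =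
    (?r \<cdot>\<^sub>m ?u) * ?b + (?r \<cdot>\<^sub>m (?u * (?a * ?R)) + ?C * ?R) * ?B"
    by (rule append_cols_mult_append_rows) (use c uaR CR in auto)
  also have "(?r \<cdot>\<^sub>m ?u) * ?b = ?r \<cdot>\<^sub>m (?u * ?b)" by (rule mult_smult_assoc_mat[OF c(5,4)])
  also have "(?r \<cdot>\<^sub>m (?u * (?a * ?R)) + ?C * ?R) * ?B = ?r \<cdot>\<^sub>m (?u * (?a * ?R)) * ?B + ?C * ?R * ?B"
    by (rule add_mult_distrib_mat) (use uaR CR c in auto)
  also have "?r \<cdot>\<^sub>m (?u * (?a * ?R)) * ?B = ?r \<cdot>\<^sub>m (?u * (?a * ?R * ?B))"
    unfolding mult_smult_assoc_mat[OF uaR c(1)] assoc_mult_mat[OF c(5) aR c(1)] ..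
  also have "?r \<cdot>\<^sub>m (?u * ?b) + (?r \<cdot>\<^sub>m (?u * (?a * ?R * ?B)) + ?C * ?R * ?B) =
    ?C * ?R * ?B + ?r \<cdot>\<^sub>m (?u * ?b + ?u * (?a * ?R * ?B))"
  proof -
    have "k \<cdot>\<^sub>m X + (k \<cdot>\<^sub>m Y + Z) = Z + k \<cdot>\<^sub>m (X + Y)" if "X \<in> carrier_mat p p" "Y \<in> carrier_mat p p"
      "Z \<in> carrier_mat p p" for k and X Y Z :: "complex poly fract mat"
      by (rule eq_matI) (use that in \<open>auto simp: algebra_simps\<close>)
    from this[OF ub uaRB CRB] show ?thesis .
  qed
  also have "?u * ?b + ?u * (?a * ?R * ?B) = ?u * (?b + ?a * ?R * ?B)"
    by (rule mult_add_distrib_mat[symmetric]) (use c aRB in auto)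
  finally show ?thesis unfolding 1 row .
qed

section \<open>The elementary step for one state\<close>

lemma pos_def_one: "pos_def n (1\<^sub>m n)"
  unfolding pos_def_def hermitian_def
proof (intro conjI ballI impI)
  fix v :: "complex vec" assume v: "v \<in> carrier_vec n" "v \<noteq> 0\<^sub>v n"
  hence "v \<bullet>c v \<noteq> 0" using conjugate_square_eq_0_vec by blast
  hence "(\<Sum>i<dim_vec v. (cmod (v $ i))\<^sup>2) \<noteq> 0" unfolding inner_self by (simp only: of_real_eq_0_iff not_False_eq_True)
  moreover have "(\<Sum>i<dim_vec v. (cmod (v $ i))\<^sup>2) \<ge> 0" by (rule sum_nonneg) simp
  ultimately show "Re ((1\<^sub>m n *\<^sub>v v) \<bullet>c v) > 0" using v by (simp add: inner_self del: of_real_power of_real_sum)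
qed auto

text \<open>Uniqueness of the positive root: if \<open>S\<^sup>2 = 1\<close>, every column \<open>x\<close> of \<open>S - 1\<close> satisfies \<open>S x = - x\<close>,
  which positive definiteness allows only for \<open>x = 0\<close>.\<close>

lemma mat_sqrt_one: "mat_sqrt (1\<^sub>m n) = 1\<^sub>m n"
  unfolding mat_sqrt_def
proof (rule the_equality)
  show "pos_def (dim_row (1\<^sub>m n)) (1\<^sub>m n) \<and> 1\<^sub>m n * 1\<^sub>m n = (1\<^sub>m n :: complex mat)"
    using pos_def_one by simp
next
  fix S :: "complex mat" assume "pos_def (dim_row (1\<^sub>m n :: complex mat)) S \<and> S * S = 1\<^sub>m n"
  hence pd: "pos_def n S" and SS: "S * S = 1\<^sub>m n" and S: "S \<in> carrier_mat n n"
    by (auto simp: pos_def_def hermitian_def)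
  define X where "X = S - 1\<^sub>m n"
  have X: "X \<in> carrier_mat n n" unfolding X_def by (rule minus_carrier_mat) simp
  have SX: "S * X = - X"
  proof -
    have "S * X = 1\<^sub>m n - S" unfolding X_def using S by (simp add: mult_minus_distrib_mat[of _ n n _ n] SS)
    thus ?thesis unfolding X_def using S by (auto intro!: eq_matI)
  qed
  have "col X j = 0\<^sub>v n" if j: "j < n" for j
  proof (rule ccontr)
    assume ne: "col X j \<noteq> 0\<^sub>v n"
    have x: "col X j \<in> carrier_vec n" using X j by auto
    have "S *\<^sub>v col X j = col (- X) j"
      unfolding SX[symmetric] by (rule col_mult2[OF S X j, symmetric])
    also have "\<dots> = - col X j" using X j by (intro eq_vecI) auto
    finally have "S *\<^sub>v col X j = - col X j" .
    moreover have "Re ((S *\<^sub>v col X j) \<bullet>c col X j) > 0" using pd x ne unfolding pos_def_def by blast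
    ultimately have "Re ((- col X j) \<bullet>c col X j) > 0" by (simp only:)
    moreover have "(- col X j) \<bullet>c col X j = - (col X j \<bullet>c col X j)"
      by (rule scalar_prod_uminus_left) (use x in simp)
    moreover have "Re (col X j \<bullet>c col X j) \<ge> 0" unfolding inner_self by (simp add: sum_nonneg)
    ultimately show False by simp
  qed
  hence "X $$ (i, j) = 0" if "i < n" "j < n" for i j
    using that X by (metis carrier_matD index_col index_zero_vec(1))
  thus "S = 1\<^sub>m n" using S unfolding X_def by (intro eq_matI) auto
qed

lemma sig_J_carrier [simp]: "sig_J p \<in> carrier_mat (p + p) (p + p)"
  by (simp add: sig_J_def)

lemma append_zero_mult_sig_J:
  assumes "A \<in> carrier_mat r p"
  shows "(A @\<^sub>c 0\<^sub>m r p) * sig_J p = A @\<^sub>c 0\<^sub>m r p"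
  unfolding sig_J_def using assms
  by (subst append_cols_mult_four_block[of _ r p _ p _ p _ p]) auto

lemma column_gram:
  assumes "v \<in> carrier_mat k 1"
  shows "(v\<^sup>H * v) $$ (0, 0) = of_real (\<Sum>i<k. (cmod (v $$ (i, 0)))\<^sup>2)"
  using assms by (auto simp: scalar_prod_def atLeast0LessThan complex_norm_square mult.commute
      simp del: of_real_power)

text \<open>The data of one step: the Schur vector \<open>(u; w)\<close> of norm one with its eigenvalue in the open
  disc.\<close>

locale schur_step =
  fixes p :: nat and w :: complex and u :: "complex mat"
  assumes u [simp]: "u \<in> carrier_mat p 1"
    and w: "cmod w < 1"
    and uu: "u\<^sup>H * u = (1 - cnj w * w) \<cdot>\<^sub>m 1\<^sub>m 1"
begin

text \<open>The blocks \<open>X\<close> and \<open>Y\<close> of \<open>\<tau>(w, u, 0)\<close>.\<close>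

definition X where "X = 1\<^sub>m p - inverse (1 - cnj w) \<cdot>\<^sub>m (u * u\<^sup>H)"
definition Y where "Y = ((1 - w) * inverse (1 - cnj w)) \<cdot>\<^sub>m u\<^sup>H"

lemma w_ne_1: "1 - w \<noteq> 0" "1 - cnj w \<noteq> 0"
proof -
  show "1 - w \<noteq> 0" using w by auto
  hence "cnj (1 - w) \<noteq> 0" by (simp only: complex_cnj_zero_iff not_False_eq_True)
  thus "1 - cnj w \<noteq> 0" by simp
qed

lemma u_dims [simp]: "dim_row u = p" "dim_col u = 1"
  using carrier_matD[OF u] by simp_all

text \<open>The factor \<open>(1 - w) / (1 - cnj w)\<close> in \<open>Y\<close> has modulus one.\<close>

lemma phase: "(1 - w) * inverse (1 - cnj w) * ((1 - cnj w) * inverse (1 - w)) = 1"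
proof -
  have "(1 - w) * inverse (1 - cnj w) * ((1 - cnj w) * inverse (1 - w)) =
    ((1 - w) * inverse (1 - w)) * ((1 - cnj w) * inverse (1 - cnj w))"
    by (simp only: mult_ac)
  thus ?thesis by (simp only: right_inverse[OF w_ne_1(1)] right_inverse[OF w_ne_1(2)] mult_1)
qed

lemma uH [simp]: "u\<^sup>H \<in> carrier_mat 1 p" by simp

lemma uuH [simp]: "u * u\<^sup>H \<in> carrier_mat p p" by (rule mult_carrier_mat[of _ p 1]) auto

lemma X_carrier [simp]: "X \<in> carrier_mat p p" and Y_carrier [simp]: "Y \<in> carrier_mat 1 p"
  unfolding X_def Y_def by auto

lemma XY_dims [simp]: "dim_row X = p" "dim_col X = p" "dim_row Y = 1" "dim_col Y = p"
  using X_carrier Y_carrier by (simp_all only: carrier_matD)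

lemma XHX [simp]: "X\<^sup>H * X \<in> carrier_mat p p" and YHY [simp]: "Y\<^sup>H * Y \<in> carrier_mat p p"
  by (simp_all add: mult_carrier_mat[of _ p p] mult_carrier_mat[of _ p 1])

lemma uHuuH: "u\<^sup>H * (u * u\<^sup>H) = (1 - cnj w * w) \<cdot>\<^sub>m u\<^sup>H"
  by (simp add: assoc_mult_mat[symmetric, of _ 1 p _ 1 _ p] uu smult_one_mult[of _ 1 p])

lemma uuHuuH: "(u * u\<^sup>H) * (u * u\<^sup>H) = (1 - cnj w * w) \<cdot>\<^sub>m (u * u\<^sup>H)"
  by (simp add: assoc_mult_mat[of _ p 1 _ p _ p] uHuuH mult_smult_distrib[of _ p 1 _ p])

lemma X_adjoint: "X\<^sup>H = 1\<^sub>m p - inverse (1 - w) \<cdot>\<^sub>m (u * u\<^sup>H)"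
  unfolding X_def by (simp add: adjoint_minus[of _ p p] adjoint_mult[of _ p 1 _ p])

lemma Y_adjoint: "Y\<^sup>H = ((1 - cnj w) * inverse (1 - w)) \<cdot>\<^sub>m u"
  unfolding Y_def by simp

text \<open>\<open>X\<^sup>H X = 1 - u u\<^sup>H\<close>, because the coefficients of \<open>u u\<^sup>H\<close> coming from the two
  factors and from \<open>u\<^sup>H u = 1 - |w|\<^sup>2\<close> add up to one; and \<open>Y\<^sup>H Y = u u\<^sup>H\<close>.\<close>

lemma XX_YY: "X\<^sup>H * X + Y\<^sup>H * Y = 1\<^sub>m p"
proof -
  let ?E = "u * u\<^sup>H" and ?k = "inverse (1 - cnj w)" and ?k' = "inverse (1 - w)"
  have 1: "X\<^sup>H * X = 1\<^sub>m p - ?k' \<cdot>\<^sub>m ?E - ?k \<cdot>\<^sub>m (?E - (?k' * (1 - cnj w * w)) \<cdot>\<^sub>m ?E)"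
    unfolding X_adjoint unfolding X_def
    by (simp add: minus_mult_distrib_mat[of _ p p _ _ p] mult_minus_distrib_mat[of _ p p _ p] minus_carrier_mat
        mult_smult_distrib[of _ p p _ p] mult_smult_assoc_mat[of _ p p _ p] uuHuuH smult_smult_mat mult.assoc)
  have 2: "Y\<^sup>H * Y = ?E"
    unfolding Y_adjoint unfolding Y_def
      by (simp add: phase mult_smult_distrib[of _ p 1 _ p] mult_smult_assoc_mat[of _ p 1 _ p] smult_smult_mat)
  \<comment> \<open>\<open>k k' (1 - |w|\<^sup>2) = k + k' - 1\<close>, since \<open>1 - |w|\<^sup>2 = (1 - cnj w) + cnj w (1 - w)\<close>.\<close>
  have id: "x - ?k' * e - ?k * (e - ?k' * (1 - cnj w * w) * e) + e = x" for x e
  proof -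
    have "x - k' * e - k * (e - k' * (1 - v * w) * e) + e = x"
      if k: "k * (1 - v) = 1" and k': "k' * (1 - w) = 1" for k k' v w :: complex
    proof -
      have kv: "k * v = k - 1" using k by (simp add: algebra_simps)
      have "k * k' * (1 - v * w) = k' * (k * (1 - v)) + k * v * (k' * (1 - w))"
        by (simp add: algebra_simps)
      hence "k * k' * (1 - v * w) = k' + (k - 1)" using k k' kv by simp
      hence "k * (k' * (1 - v * w) * e) = (k' + (k - 1)) * e" by (metis mult.assoc)
      thus ?thesis by (simp only: right_diff_distrib[of k]) (simp add: algebra_simps)
    qed
    thus ?thesis using w_ne_1 by (metis left_inverse)
  qed
  have gen: "1\<^sub>m p - ?k' \<cdot>\<^sub>m E - ?k \<cdot>\<^sub>m (E - (?k' * (1 - cnj w * w)) \<cdot>\<^sub>m E) + E = 1\<^sub>m p"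
    if "E \<in> carrier_mat p p" for E
    by (rule eq_matI) (use that in \<open>simp_all add: id\<close>)
  show ?thesis unfolding 1 2 by (rule gen) simp
qed

text \<open>The adjoint \<open>(X\<^sup>H Y\<^sup>H)\<close> of the isometry \<open>(X; Y)\<close> is a left inverse, so \<open>M = X\<^sup>H N + Y\<^sup>H r\<close>;
  the orthogonality of \<open>(u; w)\<close> and \<open>(N; r)\<close> reduces this to a rank-one correction of \<open>N\<close>, and it
  also says that \<open>(N; r)\<close> lies in the range of \<open>(X; Y)\<close>.\<close>

lemma step_inverse:
  assumes M: "M \<in> carrier_mat p k" and N: "N \<in> carrier_mat p k" and r: "r \<in> carrier_mat 1 k"
    and orth: "u\<^sup>H * N = - cnj w \<cdot>\<^sub>m r"
  shows "X * M = N \<and> Y * M = r \<longleftrightarrow> M = N + inverse (1 - w) \<cdot>\<^sub>m (u * r)"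
proof
  let ?k = "inverse (1 - cnj w)" and ?k' = "inverse (1 - w)"
  have ur: "u * r \<in> carrier_mat p k" using r by auto
  have uuN: "u * u\<^sup>H * N = - cnj w \<cdot>\<^sub>m (u * r)"
    using N r by (simp add: assoc_mult_mat[of _ p 1 _ p _ k] orth mult_smult_distrib[of _ p 1 _ k])
  {
    assume *: "X * M = N \<and> Y * M = r"
    have "M = (X\<^sup>H * X + Y\<^sup>H * Y) * M" using M by (simp add: XX_YY)
    also have "\<dots> = X\<^sup>H * N + Y\<^sup>H * r"
      using M by (simp add: add_mult_distrib_mat[of _ p p _ _ k] * assoc_mult_mat[of _ p p _ p _ k]
        assoc_mult_mat[of _ p 1 _ p _ k])
    also have "\<dots> = N - ?k' \<cdot>\<^sub>m (- cnj w \<cdot>\<^sub>m (u * r)) + ((1 - cnj w) * ?k') \<cdot>\<^sub>m (u * r)"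
      unfolding X_adjoint Y_adjoint using N r
      by (simp add: minus_mult_distrib_mat[of _ p p _ _ k] mult_smult_assoc_mat[of _ p p _ k]
        mult_smult_assoc_mat[of _ p 1 _ k] uuN)
    also have "\<dots> = N + ?k' \<cdot>\<^sub>m (u * r)"
    proof -
      have gen: "N - ?k' \<cdot>\<^sub>m (- cnj w \<cdot>\<^sub>m E) + ((1 - cnj w) * ?k') \<cdot>\<^sub>m E = N + ?k' \<cdot>\<^sub>m E"
        if "E \<in> carrier_mat p k" for E
        by (rule eq_matI) (use that N in \<open>auto simp: algebra_simps\<close>)
      show ?thesis by (rule gen[OF ur])
    qed
    finally show "M = N + ?k' \<cdot>\<^sub>m (u * r)" .
  }
  assume Meq: "M = N + ?k' \<cdot>\<^sub>m (u * r)"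
  have uM: "u\<^sup>H * M = ((1 - cnj w) * ?k') \<cdot>\<^sub>m r"
  proof -
    have "u\<^sup>H * M = - cnj w \<cdot>\<^sub>m r + ?k' \<cdot>\<^sub>m ((1 - cnj w * w) \<cdot>\<^sub>m r)"
      unfolding Meq using N r ur
      by (simp add: mult_add_distrib_mat[of _ 1 p _ k] orth mult_smult_distrib[of _ 1 p _ k]
        assoc_mult_mat[symmetric, of _ 1 p _ 1 _ k] uu smult_one_mult[of _ 1 k])
    also have "\<dots> = ((1 - cnj w) * ?k') \<cdot>\<^sub>m r"
      by (rule eq_matI) (use r w_ne_1 in \<open>auto simp: field_simps\<close>)
    finally show ?thesis .
  qed
  have "Y * M = ((1 - w) * ?k) \<cdot>\<^sub>m (((1 - cnj w) * ?k') \<cdot>\<^sub>m r)"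
    unfolding Y_def using M by (simp add: mult_smult_assoc_mat[of _ 1 p _ k] uM)
  also have "\<dots> = r" by (simp only: smult_smult_mat phase one_smult)
  finally have Y: "Y * M = r" .
  have "X * M = M - ?k \<cdot>\<^sub>m (((1 - cnj w) * ?k') \<cdot>\<^sub>m (u * r))"
    unfolding X_def using M r by (simp add: minus_mult_distrib_mat[of _ p p _ _ k] mult_smult_assoc_mat[of _ p p _ k]
      assoc_mult_mat[of _ p 1 _ p _ k] uM mult_smult_distrib[of _ p 1 _ k])
  also have "\<dots> = N"
  proof -
    have id: "x + ?k' * e - ?k * ((1 - cnj w) * ?k' * e) = x" for x e
    proof -
      have "?k * ((1 - cnj w) * ?k' * e) = ((1 - cnj w) * ?k) * (?k' * e)" by (simp only: mult_ac)
      thus ?thesis by (simp only: right_inverse[OF w_ne_1(2)] mult_1 add_diff_cancel_right')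
    qed
    have gen: "N + ?k' \<cdot>\<^sub>m E - ?k \<cdot>\<^sub>m (((1 - cnj w) * ?k') \<cdot>\<^sub>m E) = N" if "E \<in> carrier_mat p k" for E
      by (rule eq_matI) (use that N in \<open>simp_all add: left_inverse[OF w_ne_1(2)]\<close>)
    show ?thesis unfolding Meq by (rule gen[OF ur])
  qed
  finally show "X * M = N \<and> Y * M = r" using Y by simp
qed

abbreviation "W \<equiv> w \<cdot>\<^sub>m 1\<^sub>m 1 :: complex mat"

lemma w_defect: "1 - cnj w * w \<noteq> 0"
proof
  assume "1 - cnj w * w = 0"
  hence "complex_of_real ((cmod w)\<^sup>2) = of_real 1" by (simp only: complex_norm_square) (simp add: mult.commute)
  hence "(cmod w)\<^sup>2 = 1" by (rule of_real_eq_iff[THEN iffD1])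
  moreover have "(cmod w)\<^sup>2 < 1" using w by (simp add: power_less_one_iff abs_square_less_1)
  ultimately show False by simp
qed

text \<open>With one state the Stein equation is the scalar equation \<open>(1 - |w|\<^sup>2) P = 1 - |w|\<^sup>2\<close>.\<close>

lemma stein_solution_one: "stein_solution W u (0\<^sub>m p 1) = 1\<^sub>m 1"
proof -
  have eq: "P - W\<^sup>H * P * W = u\<^sup>H * u - (0\<^sub>m p 1)\<^sup>H * 0\<^sub>m p 1 \<longleftrightarrow> P = 1\<^sub>m 1" (is "?L \<longleftrightarrow> _")
    if P: "P \<in> carrier_mat 1 1" for P
  proof -
    have WP: "W\<^sup>H * P * W = (w * cnj w) \<cdot>\<^sub>m P"
      using P by (simp add: smult_one_mult[of _ 1 1] mult_smult_distrib[of _ 1 1 _ 1] smult_smult_mat)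
    have R: "u\<^sup>H * u - (0\<^sub>m p 1)\<^sup>H * 0\<^sub>m p 1 = (1 - cnj w * w) \<cdot>\<^sub>m 1\<^sub>m 1"
      unfolding uu by (rule eq_matI) auto
    have "?L \<longleftrightarrow> P $$ (0, 0) - w * cnj w * P $$ (0, 0) = 1 - cnj w * w"
      unfolding WP R mat_eq_iff using P by (auto simp: One_nat_def)
    also have "\<dots> \<longleftrightarrow> (1 - cnj w * w) * P $$ (0, 0) = (1 - cnj w * w) * 1" by (simp add: algebra_simps)
    also have "\<dots> \<longleftrightarrow> P $$ (0, 0) = 1" using w_defect by (simp only: mult_cancel_left simp_thms)
    also have "\<dots> \<longleftrightarrow> P = 1\<^sub>m 1" unfolding mat_eq_iff using P by (auto simp: One_nat_def)
    finally show ?thesis .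
  qed
  have dim: "dim_row W = 1" by simp
  show ?thesis unfolding stein_solution_def dim
    by (rule the_equality) (use eq one_carrier_mat in blast)+
qed

lemma tau_eq:
  "tau W u (0\<^sub>m p 1) = (four_block_mat X u Y W, 1\<^sub>m (p + 1))"
proof -
  have inv: "mat_inv (1\<^sub>m 1 - W\<^sup>H) = inverse (1 - cnj w) \<cdot>\<^sub>m 1\<^sub>m 1"
  proof -
    have "1\<^sub>m 1 - W\<^sup>H = (1 - cnj w) \<cdot>\<^sub>m 1\<^sub>m 1" by (rule eq_matI) auto
    thus ?thesis using mat_inv_smult_one[OF w_ne_1(2), of 1] by simp
  qed
  have Xe: "1\<^sub>m p - u * mat_inv (1\<^sub>m 1 - W\<^sup>H) * u\<^sup>H = X"
    unfolding inv X_def by (simp add: smult_one_mult(2)[of _ p 1] mult_smult_assoc_mat[of _ p 1 _ p])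
  have Ye: "(1\<^sub>m 1 - W) * mat_inv (1\<^sub>m 1 - W\<^sup>H) * u\<^sup>H = Y"
  proof -
    have "1\<^sub>m 1 - W = (1 - w) \<cdot>\<^sub>m 1\<^sub>m 1" by (rule eq_matI) auto
    thus ?thesis unfolding inv Y_def
      by (simp add: smult_one_mult[of _ 1 1] smult_one_mult[of _ 1 p] smult_smult_mat mult.commute)
  qed
  have K: "u\<^sup>H * u + W\<^sup>H * W = 1\<^sub>m 1"
    unfolding uu by (rule eq_matI) (auto simp: smult_one_mult[of _ 1 1] algebra_simps)
  have L: "u\<^sup>H * X + W\<^sup>H * 1\<^sub>m 1 * Y = 0\<^sub>m 1 p"
  proof -
    have "u\<^sup>H * X = u\<^sup>H - inverse (1 - cnj w) \<cdot>\<^sub>m ((1 - cnj w * w) \<cdot>\<^sub>m u\<^sup>H)"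
      unfolding X_def by (simp add: mult_minus_distrib_mat[of _ 1 p _ p] mult_smult_distrib[of _ 1 p _ p] uHuuH)
    moreover have "W\<^sup>H * 1\<^sub>m 1 * Y = cnj w \<cdot>\<^sub>m Y"
      by (simp add: smult_one_mult[of _ 1 1] smult_one_mult[of _ 1 p])
    ultimately show ?thesis unfolding Y_def
      by (intro eq_matI) (use w_ne_1 in \<open>auto simp: field_simps\<close>)
  qed
  have UUe: "four_block_mat X u Y W * four_block_mat (1\<^sub>m p) (0\<^sub>m p 1) (- 0\<^sub>m 1 p) (1\<^sub>m 1) = four_block_mat X u Y W"
    by (simp add: uminus_zero_mat mult_four_block_mat[of _ p p _ 1 _ 1 _ _ p _ 1])
  have Z: "X\<^sup>H * X + Y\<^sup>H * 1\<^sub>m 1 * Y = 1\<^sub>m p"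
    using XX_YY by (simp add: right_mult_one_mat[of _ p])
  have V: "1\<^sub>m p + 0\<^sub>m p 1 * (0\<^sub>m p 1)\<^sup>H = (1\<^sub>m p :: complex mat)"
    "1\<^sub>m 1 + (0\<^sub>m p 1)\<^sup>H * 0\<^sub>m p 1 = (1\<^sub>m 1 :: complex mat)" by simp_all
  have one: "u * 1\<^sub>m 1 = u" "1\<^sub>m 1 * W * 1\<^sub>m 1 = W" "0\<^sub>m p 1 * 1\<^sub>m 1 = (0\<^sub>m p 1 :: complex mat)" "1\<^sub>m 1 * Y = Y"
    by (simp_all add: left_mult_one_mat[of _ 1 p])
  have dims: "dim_row W = 1" by simp
  show ?thesis
    unfolding tau_def Let_def u_dims dims stein_solution_one mat_sqrt_one mat_inv_one one Xe Ye K L V Z one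
    by (simp add: UUe uminus_zero_mat)
qed

text \<open>The rank-one term of \<open>H\<close> is \<open>u Y / (1 - w) = u u\<^sup>H / (1 - cnj w)\<close>, which is what \<open>X\<close> lacks
  to the identity.\<close>

lemma H_mat_eq: "H_mat p (four_block_mat X u Y W) (1\<^sub>m (p + 1)) = 1\<^sub>m (p + p)"
proof -
  have V: "1\<^sub>m (p + 1) = four_block_mat (1\<^sub>m p) (0\<^sub>m p 1) (0\<^sub>m 1 p) (1\<^sub>m 1 :: complex mat)" by simp
  have split: "split_block (four_block_mat X u Y W) p p = (X, u, Y, W)"
    "split_block (1\<^sub>m (p + 1) :: complex mat) p p = (1\<^sub>m p, 0\<^sub>m p 1, 0\<^sub>m 1 p, 1\<^sub>m 1)"
    unfolding V by (rule split_block_four_block[of _ p p _ 1 _ 1]; simp)+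
  have "1\<^sub>m 1 - W = (1 - w) \<cdot>\<^sub>m 1\<^sub>m 1" by (rule eq_matI) auto
  hence inv: "mat_inv (1\<^sub>m 1 - W) = inverse (1 - w) \<cdot>\<^sub>m 1\<^sub>m 1"
    using mat_inv_smult_one[OF w_ne_1(1), of 1] by simp
  have col: "u @\<^sub>r 0\<^sub>m p 1 \<in> carrier_mat (p + p) 1" by (rule carrier_append_rows) auto
  have row: "Y @\<^sub>c 0\<^sub>m 1 p \<in> carrier_mat 1 (p + p)" by (rule append_cols_carrier) auto
  have uY: "inverse (1 - w) \<cdot>\<^sub>m u * Y = inverse (1 - cnj w) \<cdot>\<^sub>m (u * u\<^sup>H)"
  proof -
    have "(1 - w) * inverse (1 - cnj w) * inverse (1 - w) = (1 - w) * inverse (1 - w) * inverse (1 - cnj w)"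
      by (simp only: mult_ac)
    hence c: "(1 - w) * inverse (1 - cnj w) * inverse (1 - w) = inverse (1 - cnj w)"
      by (simp only: right_inverse[OF w_ne_1(1)] mult_1)
    show ?thesis unfolding Y_def
      by (simp add: c mult_smult_distrib[of _ p 1 _ p] mult_smult_assoc_mat[of _ p 1 _ p] smult_smult_mat)
  qed
  have "(u @\<^sub>r 0\<^sub>m p 1) * mat_inv (1\<^sub>m 1 - W) * (Y @\<^sub>c 0\<^sub>m 1 p) * sig_J p =
    inverse (1 - w) \<cdot>\<^sub>m (u @\<^sub>r 0\<^sub>m p 1) * ((Y @\<^sub>c 0\<^sub>m 1 p) * sig_J p)"
    unfolding inv smult_one_mult(2)[OF col]
    by (rule assoc_mult_mat[of _ "p + p" 1 _ "p + p" _ "p + p"]) (use col row in auto)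
  also have "\<dots> = (inverse (1 - w) \<cdot>\<^sub>m u @\<^sub>r 0\<^sub>m p 1) * (Y @\<^sub>c 0\<^sub>m 1 p)"
  proof -
    have "inverse (1 - w) \<cdot>\<^sub>m (u @\<^sub>r 0\<^sub>m p 1) = inverse (1 - w) \<cdot>\<^sub>m u @\<^sub>r 0\<^sub>m p 1"
      by (rule eq_matI) auto
    thus ?thesis by (simp add: append_zero_mult_sig_J)
  qed
  also have "\<dots> = four_block_mat (inverse (1 - cnj w) \<cdot>\<^sub>m (u * u\<^sup>H)) (0\<^sub>m p p) (0\<^sub>m p p) (0\<^sub>m p p)"
    by (subst append_rows_mult_append_cols[of _ p 1 _ p _ p _ p]) (auto simp: uY)
  finally have rank_one: "(u @\<^sub>r 0\<^sub>m p 1) * mat_inv (1\<^sub>m 1 - W) * (Y @\<^sub>c 0\<^sub>m 1 p) * sig_J p =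
    four_block_mat (inverse (1 - cnj w) \<cdot>\<^sub>m (u * u\<^sup>H)) (0\<^sub>m p p) (0\<^sub>m p p) (0\<^sub>m p p)" .
  have "X + inverse (1 - cnj w) \<cdot>\<^sub>m (u * u\<^sup>H) = 1\<^sub>m p"
  proof -
    have "1\<^sub>m p - k \<cdot>\<^sub>m E + k \<cdot>\<^sub>m E = 1\<^sub>m p" if "E \<in> carrier_mat p p" for k :: complex and E
      by (rule eq_matI) (use that in auto)
    thus ?thesis unfolding X_def by simp
  qed
  thus ?thesis
    unfolding H_mat_def split prod.case rank_one
    by (subst add_four_block_mat[of _ p p _ p _ p]) auto
qed

definition inv_z_minus_w :: "complex poly fract" where
  "inv_z_minus_w = inverse (var_z - to_fract [:w:])"

text \<open>The Blaschke-Potapov factor of degree one with pole \<open>w\<close> and direction \<open>u\<close>, normalized to be the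
  identity at \<open>z = 1\<close>.\<close>

definition blaschke :: "complex poly fract mat" where
  "blaschke = 1\<^sub>m p - ((var_z - 1) * inv_z_minus_w * to_fract [:inverse (1 - cnj w):]) \<cdot>\<^sub>m const_mat (u * u\<^sup>H)"

lemma var_minus_w: "var_z - to_fract [:w:] \<noteq> 0"
  unfolding var_z_def to_fract_diff[symmetric] by simp

lemma resolvent_W: "resolvent W = inv_z_minus_w \<cdot>\<^sub>m 1\<^sub>m 1"
proof (rule resolvent_eqI)
  have "var_z \<cdot>\<^sub>m 1\<^sub>m 1 - const_mat W = (var_z - to_fract [:w:]) \<cdot>\<^sub>m 1\<^sub>m 1"
    by (simp add: const_mat_smult) (rule eq_matI, auto)
  thus "(var_z \<cdot>\<^sub>m 1\<^sub>m 1 - const_mat W) * (inv_z_minus_w \<cdot>\<^sub>m 1\<^sub>m 1) = 1\<^sub>m 1"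
    using var_minus_w by (simp add: smult_one_mult[of _ 1 1] smult_smult_mat inv_z_minus_w_def)
qed auto

lemma blaschke_carrier: "blaschke \<in> carrier_mat p p"
  unfolding blaschke_def by (rule minus_carrier_mat) simp

lemma Theta_hat_eq:
  "Theta_hat W u (0\<^sub>m p 1) = four_block_mat blaschke (0\<^sub>m p p) (0\<^sub>m p p) (1\<^sub>m p)"
proof -
  let ?k = "inverse (1 - cnj w)"
  have "1\<^sub>m 1 - W = (1 - w) \<cdot>\<^sub>m 1\<^sub>m 1" by (rule eq_matI) auto
  hence "(mat_inv (1\<^sub>m 1 - W))\<^sup>H = cnj (inverse (1 - w)) \<cdot>\<^sub>m 1\<^sub>m 1"
    using mat_inv_smult_one[OF w_ne_1(1), of 1] by simp
  hence inv: "(mat_inv (1\<^sub>m 1 - W))\<^sup>H = ?k \<cdot>\<^sub>m 1\<^sub>m 1" by simp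
  have adj: "(u @\<^sub>r 0\<^sub>m p 1)\<^sup>H = u\<^sup>H @\<^sub>c 0\<^sub>m 1 p"
    by (simp add: adjoint_append_rows[of _ p 1 _ p])
  have uc: "u\<^sup>H @\<^sub>c 0\<^sub>m 1 p \<in> carrier_mat 1 (p + p)" by (rule append_cols_carrier) auto
  have "1\<^sub>m 1 * (?k \<cdot>\<^sub>m 1\<^sub>m 1) * (u\<^sup>H @\<^sub>c 0\<^sub>m 1 p) * sig_J p = ?k \<cdot>\<^sub>m ((u\<^sup>H @\<^sub>c 0\<^sub>m 1 p) * sig_J p)"
    using uc by (simp add: smult_one_mult[of _ 1 "p + p"] mult_smult_assoc_mat[of _ 1 "p + p" _ "p + p"])
  also have "\<dots> = ?k \<cdot>\<^sub>m (u\<^sup>H @\<^sub>c 0\<^sub>m 1 p)" by (simp add: append_zero_mult_sig_J)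
  finally have right: "1\<^sub>m 1 * (?k \<cdot>\<^sub>m 1\<^sub>m 1) * (u\<^sup>H @\<^sub>c 0\<^sub>m 1 p) * sig_J p = ?k \<cdot>\<^sub>m (u\<^sup>H @\<^sub>c 0\<^sub>m 1 p)" .
  let ?cu = "const_mat u" and ?cuH = "const_mat (u\<^sup>H)"
  have cu: "?cu \<in> carrier_mat p 1" "?cuH \<in> carrier_mat 1 p" by auto
  have col: "const_mat (u @\<^sub>r 0\<^sub>m p 1) = ?cu @\<^sub>r 0\<^sub>m p 1"
    by (simp add: const_mat_append_rows[of _ p 1 _ p])
  have row: "const_mat (?k \<cdot>\<^sub>m (u\<^sup>H @\<^sub>c 0\<^sub>m 1 p)) = to_fract [:?k:] \<cdot>\<^sub>m (?cuH @\<^sub>c 0\<^sub>m 1 p)"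
    by (simp add: const_mat_smult const_mat_append_cols[of _ 1 p _ p])
  have c: "?cu @\<^sub>r 0\<^sub>m p 1 \<in> carrier_mat (p + p) 1" by (rule carrier_append_rows) auto
  have r: "?cuH @\<^sub>c 0\<^sub>m 1 p \<in> carrier_mat 1 (p + p)" by (rule append_cols_carrier) auto
  have cuu: "?cu * ?cuH = const_mat (u * u\<^sup>H)" by (simp add: const_mat_mult[of _ p 1 _ p])
  have E: "const_mat (u * u\<^sup>H) \<in> carrier_mat p p" by simp
  have "const_mat (u @\<^sub>r 0\<^sub>m p 1) * resolvent W * const_mat (?k \<cdot>\<^sub>m (u\<^sup>H @\<^sub>c 0\<^sub>m 1 p)) =
    (inv_z_minus_w * to_fract [:?k:]) \<cdot>\<^sub>m ((?cu @\<^sub>r 0\<^sub>m p 1) * (?cuH @\<^sub>c 0\<^sub>m 1 p))"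
    unfolding col row resolvent_W smult_one_mult(2)[OF c]
    using c r by (simp add: mult_smult_assoc_mat[of _ "p + p" 1 _ "p + p"] mult_smult_distrib[of _ "p + p" 1 _ "p + p"]
        smult_smult_mat mult.commute)
  also have "\<dots> = (inv_z_minus_w * to_fract [:?k:]) \<cdot>\<^sub>m four_block_mat (const_mat (u * u\<^sup>H)) (0\<^sub>m p p) (0\<^sub>m p p) (0\<^sub>m p p)"
    by (subst append_rows_mult_append_cols[OF cu(1) _ cu(2)])
      (auto simp: cuu right_mult_zero_mat[OF cu(1)] left_mult_zero_mat[OF cu(2)])
  finally have mid: "const_mat (u @\<^sub>r 0\<^sub>m p 1) * resolvent W * const_mat (?k \<cdot>\<^sub>m (u\<^sup>H @\<^sub>c 0\<^sub>m 1 p)) =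
    (inv_z_minus_w * to_fract [:?k:]) \<cdot>\<^sub>m four_block_mat (const_mat (u * u\<^sup>H)) (0\<^sub>m p p) (0\<^sub>m p p) (0\<^sub>m p p)" .
  have dims: "dim_row W = 1" by simp
  have Th: "Theta W u (0\<^sub>m p 1) = 1\<^sub>m (2 * p) - (var_z - 1) \<cdot>\<^sub>m
     ((inv_z_minus_w * to_fract [:?k:]) \<cdot>\<^sub>m four_block_mat (const_mat (u * u\<^sup>H)) (0\<^sub>m p p) (0\<^sub>m p p) (0\<^sub>m p p))"
    unfolding Theta_def Let_def stein_solution_one mat_inv_one u_dims dims inv adj right mid ..
  have "1\<^sub>m (2 * p) - c \<cdot>\<^sub>m (d \<cdot>\<^sub>m four_block_mat E (0\<^sub>m p p) (0\<^sub>m p p) (0\<^sub>m p p)) =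
    four_block_mat (1\<^sub>m p - (c * d) \<cdot>\<^sub>m E) (0\<^sub>m p p) (0\<^sub>m p p) (1\<^sub>m p)"
    if "E \<in> carrier_mat p p" for E and c d :: "complex poly fract"
    by (rule eq_matI) (use that in auto)
  from this[OF E, of "var_z - 1" "inv_z_minus_w * to_fract [:?k:]"]
  have Th': "Theta W u (0\<^sub>m p 1) = four_block_mat blaschke (0\<^sub>m p p) (0\<^sub>m p p) (1\<^sub>m p)"
    unfolding Th blaschke_def by (simp add: mult.assoc)
  show ?thesis
    unfolding Theta_hat_def tau_eq prod.case u_dims H_mat_eq Th' const_mat_one
    by (rule right_mult_one_mat) (use blaschke_carrier in auto)
qed

lemma is_LFT_Theta_hat:
  assumes "F \<in> carrier_mat p p" "G = blaschke * F"
  shows "is_LFT p (Theta_hat W u (0\<^sub>m p 1)) F G"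
proof -
  have split: "split_block (Theta_hat W u (0\<^sub>m p 1)) p p = (blaschke, 0\<^sub>m p p, 0\<^sub>m p p, 1\<^sub>m p)"
    unfolding Theta_hat_eq by (rule split_block_four_block[of _ p p _ p _ p]) (use blaschke_carrier in auto)
  have den: "0\<^sub>m p p * F + 1\<^sub>m p = 1\<^sub>m p" using assms(1) by simp
  have inv: "invertible_mat (1\<^sub>m p :: complex poly fract mat)"
    unfolding invertible_mat_def inverts_mat_def square_mat.simps by (auto intro!: exI[of _ "1\<^sub>m p"])
  have num: "blaschke * F + 0\<^sub>m p p = blaschke * F" using assms(1) blaschke_carrier by simp
  have "(blaschke * F) * 1\<^sub>m p = blaschke * F"
    by (rule right_mult_one_mat[of _ p p]) (use assms(1) blaschke_carrier in auto)
  thus ?thesis unfolding is_LFT_def split prod.case den num mat_inv_one using inv assms(2) by simp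
qed

text \<open>On the direction \<open>u\<close> everything is scalar: the hypothesis and \<open>u\<^sup>H u = 1 - |w|\<^sup>2\<close> give
  \<open>u\<^sup>H (F + u E / (1 - w)) = (1 - cnj w) / (1 - w) E\<close>, and
  \<open>1 / (1 - w) - (z - 1) / ((z - w) (1 - w)) = 1 / (z - w)\<close>.\<close>

lemma blaschke_factor:
  assumes F: "F \<in> carrier_mat p p" and E: "E \<in> carrier_mat 1 p"
    and orth: "const_mat (u\<^sup>H) * F = - to_fract [:cnj w:] \<cdot>\<^sub>m E"
  shows "F + inv_z_minus_w \<cdot>\<^sub>m (const_mat u * E) = blaschke * (F + to_fract [:inverse (1 - w):] \<cdot>\<^sub>m (const_mat u * E))"
proof -
  let ?c = "\<lambda>c. to_fract [:c:]"
  let ?cu = "const_mat u" and ?cuH = "const_mat (u\<^sup>H)" and ?k = "inverse (1 - cnj w)" and ?s = "?c (inverse (1 - w))"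
  interpret h: comm_ring_hom "\<lambda>c :: complex. to_fract [:c:]" by (rule const_comm_ring_hom)
  have cu: "?cu \<in> carrier_mat p 1" "?cuH \<in> carrier_mat 1 p" by auto
  have uE: "?cu * E \<in> carrier_mat p p" by (rule mult_carrier_mat[OF cu(1) E])
  let ?G = "F + ?s \<cdot>\<^sub>m (?cu * E)"
  have G: "?G \<in> carrier_mat p p" using F uE by auto
  have cuu: "?cuH * ?cu = ?c (1 - cnj w * w) \<cdot>\<^sub>m 1\<^sub>m 1"
    using const_mat_mult[OF uH u] by (simp add: uu const_mat_smult)
  have uG: "?cuH * ?G = ?c ((1 - cnj w) * inverse (1 - w)) \<cdot>\<^sub>m E"
  proof -
    have "?cuH * ?G = ?cuH * F + ?cuH * (?s \<cdot>\<^sub>m (?cu * E))"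
      by (rule mult_add_distrib_mat) (use cu F uE in auto)
    also have "?cuH * (?s \<cdot>\<^sub>m (?cu * E)) = ?s \<cdot>\<^sub>m (?c (1 - cnj w * w) \<cdot>\<^sub>m E)"
      using mult_smult_distrib[OF cu(2) uE] assoc_mult_mat[OF cu(2,1) E, symmetric] smult_one_mult(1)[OF E]
      by (simp add: cuu)
    also have "?cuH * F + \<dots> = (- ?c (cnj w) + ?s * ?c (1 - cnj w * w)) \<cdot>\<^sub>m E"
      unfolding orth by (rule eq_matI) (use E in \<open>auto simp: algebra_simps\<close>)
    also have "- ?c (cnj w) + ?s * ?c (1 - cnj w * w) = ?c (- cnj w + inverse (1 - w) * (1 - cnj w * w))"
      by (simp only: h.hom_add h.hom_mult h.hom_uminus)
    also have "- cnj w + inverse (1 - w) * (1 - cnj w * w) = (1 - cnj w) * inverse (1 - w)"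
      using w_ne_1(1) by (simp add: field_simps)
    finally show ?thesis .
  qed
  have "const_mat (u * u\<^sup>H) * ?G = ?cu * (?cuH * ?G)"
    unfolding const_mat_mult[OF u uH] by (rule assoc_mult_mat[OF cu G])
  also have "\<dots> = ?c ((1 - cnj w) * inverse (1 - w)) \<cdot>\<^sub>m (?cu * E)"
    unfolding uG by (rule mult_smult_distrib[OF cu(1) E])
  finally have uuG: "const_mat (u * u\<^sup>H) * ?G = ?c ((1 - cnj w) * inverse (1 - w)) \<cdot>\<^sub>m (?cu * E)" .
  let ?\<kappa> = "(var_z - 1) * inv_z_minus_w * ?c ?k"
  have "blaschke * ?G = ?G - ?\<kappa> \<cdot>\<^sub>m (const_mat (u * u\<^sup>H) * ?G)"
  proof -
    have uuc: "const_mat (u * u\<^sup>H) \<in> carrier_mat p p" by simp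
    hence kuu: "?\<kappa> \<cdot>\<^sub>m const_mat (u * u\<^sup>H) \<in> carrier_mat p p" by (rule smult_carrier_mat)
    show ?thesis
      unfolding blaschke_def minus_mult_distrib_mat[OF one_carrier_mat kuu G]
        mult_smult_assoc_mat[OF uuc G] left_mult_one_mat[OF G] ..
  qed
  also have "\<dots> = F + (?s - ?\<kappa> * ?c ((1 - cnj w) * inverse (1 - w))) \<cdot>\<^sub>m (?cu * E)"
  proof -
    have "F + s \<cdot>\<^sub>m X - k \<cdot>\<^sub>m (l \<cdot>\<^sub>m X) = F + (s - k * l) \<cdot>\<^sub>m X" if "X \<in> carrier_mat p p" for s k l X
      by (rule eq_matI) (use F that in \<open>auto simp: algebra_simps\<close>)
    from this[OF uE] show ?thesis unfolding uuG .
  qed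
  also have "?s - ?\<kappa> * ?c ((1 - cnj w) * inverse (1 - w)) = inv_z_minus_w"
  proof -
    have "?c ?k * ?c ((1 - cnj w) * inverse (1 - w)) = ?c (?k * (1 - cnj w) * inverse (1 - w))"
      by (simp only: h.hom_mult mult.assoc)
    also have "\<dots> = ?s" by (simp only: left_inverse[OF w_ne_1(2)] mult_1)
    finally have 1: "?c ?k * ?c ((1 - cnj w) * inverse (1 - w)) = ?s" .
    have s: "(1 - ?c w) * ?s = 1"
    proof -
      have "(1 - ?c w) * ?s = ?c ((1 - w) * inverse (1 - w))"
        by (simp only: h.hom_mult h.hom_minus h.hom_one)
      thus ?thesis by (simp only: right_inverse[OF w_ne_1(1)] h.hom_one)
    qed
    have r: "(var_z - ?c w) * inv_z_minus_w = 1" using var_minus_w by (simp add: inv_z_minus_w_def)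
    have "?s - ?\<kappa> * ?c ((1 - cnj w) * inverse (1 - w)) = ?s - (var_z - 1) * inv_z_minus_w * ?s"
      unfolding mult.assoc 1[unfolded mult.assoc] ..
    also have "\<dots> = ?s * ((var_z - ?c w) * inv_z_minus_w) - (var_z - 1) * inv_z_minus_w * ?s" unfolding r by simp
    also have "\<dots> = inv_z_minus_w * ((1 - ?c w) * ?s)" by (simp add: algebra_simps)
    also have "\<dots> = inv_z_minus_w" unfolding s by simp
    finally show ?thesis .
  qed
  finally show ?thesis by simp
qed

lemma tau_admissible: "tau_admissible p 1 W u (0\<^sub>m p 1)"
  unfolding tau_admissible_def
proof (intro conjI)
  show "stable_mat W" unfolding stable_mat_def
  proof (intro allI impI)
    fix k assume "eigenvalue W k"
    then obtain v where v: "v \<in> carrier_vec 1" "v \<noteq> 0\<^sub>v 1" and ev: "W *\<^sub>v v = k \<cdot>\<^sub>v v"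
      by (auto simp: eigenvalue_def eigenvector_def)
    have v0: "v $ 0 \<noteq> 0" using v by (auto simp: One_nat_def intro: eq_vecI)
    have "(W *\<^sub>v v) $ 0 = w * v $ 0" using v(1) by (simp add: scalar_prod_def One_nat_def)
    moreover have "(k \<cdot>\<^sub>v v) $ 0 = k * v $ 0" using v(1) by simp
    ultimately have "w * v $ 0 = k * v $ 0" unfolding ev by (simp only:)
    with v0 w show "cmod k < 1" by simp
  qed
  show "observable p 1 u W" unfolding observable_def
  proof (intro ballI impI)
    fix x :: "complex vec" assume x: "x \<in> carrier_vec 1" and "\<forall>k. (u * W ^\<^sub>m k) *\<^sub>v x = 0\<^sub>v p"
    hence "(u * W ^\<^sub>m 0) *\<^sub>v x = 0\<^sub>v p" by blast
    hence ux: "u *\<^sub>v x = 0\<^sub>v p" by simp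
    have "(u\<^sup>H * u) *\<^sub>v x = u\<^sup>H *\<^sub>v (u *\<^sub>v x)" by (rule assoc_mult_mat_vec[OF uH u x])
    also have "\<dots> = 0\<^sub>v 1" unfolding ux by (rule eq_vecI) (auto simp: scalar_prod_def)
    finally have "((1 - cnj w * w) \<cdot>\<^sub>m 1\<^sub>m 1 *\<^sub>v x) $ 0 = 0" unfolding uu by (simp add: One_nat_def)
    hence "(1 - cnj w * w) * x $ 0 = 0" using x by (simp add: scalar_prod_def One_nat_def)
    hence "x $ 0 = 0" using w_defect by (simp only: mult_eq_0_iff simp_thms)
    thus "x = 0\<^sub>v 1" using x by (intro eq_vecI) (auto simp: One_nat_def)
  qed
  show "u\<^sup>H * u + W\<^sup>H * W = 1\<^sub>m 1"
    unfolding uu by (rule eq_matI) (auto simp: smult_one_mult[of _ 1 1] algebra_simps)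
  show "pos_def 1 (stein_solution W u (0\<^sub>m p 1))" unfolding stein_solution_one by (rule pos_def_one)
qed auto

lemma recursion_iff:
  assumes "A \<in> carrier_mat m m" "B \<in> carrier_mat m p" "Chat \<in> carrier_mat p m" "Dt \<in> carrier_mat p p"
    "a \<in> carrier_mat 1 m" "b \<in> carrier_mat 1 p"
    and "A' \<in> carrier_mat m m" "B' \<in> carrier_mat m p" "C' \<in> carrier_mat p m" "D' \<in> carrier_mat p p"
  shows "recursion p m (four_block_mat X u Y W) (1\<^sub>m (p + 1))
     (four_block_mat W a (0\<^sub>m m 1) A) (b @\<^sub>r B) (u @\<^sub>c Chat) Dt A' B' C' D' \<longleftrightarrow>
    A' = A \<and> B' = B \<and> (X * C' = Chat \<and> Y * C' = a) \<and> (X * D' = Dt \<and> Y * D' = b)"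
proof -
  let ?U = "four_block_mat X u Y W" and ?D = "four_block_mat D' (0\<^sub>m p 1) (0\<^sub>m 1 p) (1\<^sub>m 1)"
  have U: "?U \<in> carrier_mat (p + 1) (p + 1)" and D: "?D \<in> carrier_mat (p + 1) (p + 1)"
    using assms by (auto intro!: four_block_carrier_mat)
  have C: "C' @\<^sub>r 0\<^sub>m 1 m \<in> carrier_mat (p + 1) m" and B: "B' @\<^sub>c 0\<^sub>m m 1 \<in> carrier_mat m (p + 1)"
    using assms by (auto intro!: append_cols_carrier carrier_append_rows)
  have UD: "?U * ?D = four_block_mat (X * D') u (Y * D') W"
    using assms by (subst mult_four_block_mat[of _ p p _ 1 _ 1 _ _ p _ 1]) auto
  have UC: "?U * (C' @\<^sub>r 0\<^sub>m 1 m) = X * C' @\<^sub>r Y * C'"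
    using assms by (subst four_block_mult_append_rows[of _ p p _ 1 _ 1 _ _ m]) auto
  have XD: "X * D' \<in> carrier_mat p p" "Y * D' \<in> carrier_mat 1 p"
    and XC: "X * C' \<in> carrier_mat p m" "Y * C' \<in> carrier_mat 1 m"
    using assms mult_carrier_mat[OF X_carrier] mult_carrier_mat[OF Y_carrier] by auto
  have V: "four_block_mat ((1\<^sub>m (p + 1))\<^sup>H) (0\<^sub>m (p + 1) m) (0\<^sub>m m (p + 1)) (1\<^sub>m m) = 1\<^sub>m (p + 1 + m)"
    unfolding adjoint_one by (rule four_block_one_mat)
  have P: "four_block_mat ?U (0\<^sub>m (p + 1) m) (0\<^sub>m m (p + 1)) (1\<^sub>m m) * four_block_mat ?D (C' @\<^sub>r 0\<^sub>m 1 m) (B' @\<^sub>c 0\<^sub>m m 1) A' =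
    four_block_mat (four_block_mat (X * D') u (Y * D') W) (X * C' @\<^sub>r Y * C') (B' @\<^sub>c 0\<^sub>m m 1) A'"
  proof -
    have "?U * ?D + 0\<^sub>m (p + 1) m * (B' @\<^sub>c 0\<^sub>m m 1) = ?U * ?D"
      unfolding left_mult_zero_mat[OF B] by (rule right_add_zero_mat[of _ "p + 1" "p + 1"], rule mult_carrier_mat[OF U D])
    moreover have "?U * (C' @\<^sub>r 0\<^sub>m 1 m) + 0\<^sub>m (p + 1) m * A' = ?U * (C' @\<^sub>r 0\<^sub>m 1 m)"
      unfolding left_mult_zero_mat[OF assms(7)] by (rule right_add_zero_mat[of _ "p + 1" m], rule mult_carrier_mat[OF U C])
    moreover have "0\<^sub>m m (p + 1) * ?D + 1\<^sub>m m * (B' @\<^sub>c 0\<^sub>m m 1) = B' @\<^sub>c 0\<^sub>m m 1"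
      unfolding left_mult_zero_mat[OF D] left_mult_one_mat[OF B] by (rule left_add_zero_mat[OF B])
    moreover have "0\<^sub>m m (p + 1) * (C' @\<^sub>r 0\<^sub>m 1 m) + 1\<^sub>m m * A' = A'"
      unfolding left_mult_zero_mat[OF C] left_mult_one_mat[OF assms(7)] by (rule left_add_zero_mat[OF assms(7)])
    ultimately show ?thesis
      unfolding UD[symmetric] UC[symmetric]
      using mult_four_block_mat[OF U zero_carrier_mat zero_carrier_mat one_carrier_mat D C B assms(7)] by simp
  qed
  have Pc: "four_block_mat (four_block_mat (X * D') u (Y * D') W) (X * C' @\<^sub>r Y * C') (B' @\<^sub>c 0\<^sub>m m 1) A' \<in> carrier_mat (p + 1 + m) (p + 1 + m)"
    using assms XD by (intro four_block_carrier_mat) auto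
  have lhs: "four_block_mat Dt (u @\<^sub>c Chat) (b @\<^sub>r B) (four_block_mat W a (0\<^sub>m m 1) A) =
    four_block_mat (four_block_mat Dt u b W) (Chat @\<^sub>r a) (B @\<^sub>c 0\<^sub>m m 1) A"
    by (rule four_block_regroup[of _ p p _ 1 _ m _ 1 _ m]) (use assms in auto)
  have "recursion p m ?U (1\<^sub>m (p + 1)) (four_block_mat W a (0\<^sub>m m 1) A) (b @\<^sub>r B) (u @\<^sub>c Chat) Dt A' B' C' D' \<longleftrightarrow>
    four_block_mat (four_block_mat Dt u b W) (Chat @\<^sub>r a) (B @\<^sub>c 0\<^sub>m m 1) A =
    four_block_mat (four_block_mat (X * D') u (Y * D') W) (X * C' @\<^sub>r Y * C') (B' @\<^sub>c 0\<^sub>m m 1) A'"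
    unfolding recursion_def lhs V P right_mult_one_mat[OF Pc] ..
  also have "\<dots> \<longleftrightarrow> four_block_mat Dt u b W = four_block_mat (X * D') u (Y * D') W \<and>
    Chat @\<^sub>r a = X * C' @\<^sub>r Y * C' \<and> B @\<^sub>c 0\<^sub>m m 1 = B' @\<^sub>c 0\<^sub>m m 1 \<and> A = A'"
    by (rule four_block_eq_iff[of _ "p + 1" "p + 1" _ m _ m])
      (use assms XD XC B in \<open>auto intro!: four_block_carrier_mat carrier_append_rows append_cols_carrier\<close>)
  also have "four_block_mat Dt u b W = four_block_mat (X * D') u (Y * D') W \<longleftrightarrow>
    Dt = X * D' \<and> u = u \<and> b = Y * D' \<and> W = W"
    by (rule four_block_eq_iff[of _ p p _ 1 _ 1]) (use assms XD in auto)
  also have "Chat @\<^sub>r a = X * C' @\<^sub>r Y * C' \<longleftrightarrow> Chat = X * C' \<and> a = Y * C'"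
    by (rule append_rows_eq_iff) (use assms XC in auto)
  also have "B @\<^sub>c 0\<^sub>m m 1 = B' @\<^sub>c 0\<^sub>m m 1 \<longleftrightarrow> B = B' \<and> 0\<^sub>m m 1 = (0\<^sub>m m 1 :: complex mat)"
    by (rule append_cols_eq_iff) (use assms in auto)
  finally show ?thesis by blast
qed

text \<open>Multiplication by the isometry \<open>(X; Y)\<close> preserves Gram matrices; thereby unitarity passes from
  the given realization matrix to the reduced one.\<close>

lemma gram_transfer:
  assumes M: "M \<in> carrier_mat p k" and M': "M' \<in> carrier_mat p l"
  shows "(X * M)\<^sup>H * (X * M') + (Y * M)\<^sup>H * (Y * M') = M\<^sup>H * M'"
proof -
  have MH: "M\<^sup>H \<in> carrier_mat k p" and XH: "X\<^sup>H \<in> carrier_mat p p" and YH: "Y\<^sup>H \<in> carrier_mat p 1"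
    and XM: "X * M' \<in> carrier_mat p l" and YM: "Y * M' \<in> carrier_mat 1 l"
    using M mult_carrier_mat[OF X_carrier M'] mult_carrier_mat[OF Y_carrier M'] by auto
  have XXM: "X\<^sup>H * (X * M') \<in> carrier_mat p l" and YYM: "Y\<^sup>H * (Y * M') \<in> carrier_mat p l"
    by (rule mult_carrier_mat[OF XH XM], rule mult_carrier_mat[OF YH YM])
  have "M\<^sup>H * M' = M\<^sup>H * ((X\<^sup>H * X + Y\<^sup>H * Y) * M')" using M' by (simp add: XX_YY)
  also have "(X\<^sup>H * X + Y\<^sup>H * Y) * M' = X\<^sup>H * (X * M') + Y\<^sup>H * (Y * M')"
    unfolding add_mult_distrib_mat[OF XHX YHY M'] assoc_mult_mat[OF XH X_carrier M'] assoc_mult_mat[OF YH Y_carrier M'] ..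
  also have "M\<^sup>H * \<dots> = M\<^sup>H * X\<^sup>H * (X * M') + M\<^sup>H * Y\<^sup>H * (Y * M')"
    unfolding mult_add_distrib_mat[OF MH XXM YYM] assoc_mult_mat[OF MH XH XM] assoc_mult_mat[OF MH YH YM] ..
  finally show ?thesis unfolding adjoint_mult[OF X_carrier M] adjoint_mult[OF Y_carrier M] ..
qed

end

section \<open>Balanced realizations in Schur form\<close>

text \<open>The column relations of the unitary matrix, that is \<open>M\<^sup>H M = 1\<close>, written for the partition of
  the columns into input, first state and remaining states.\<close>

lemma unitary_schur_relations:
  assumes A: "A \<in> carrier_mat m m" and B: "B \<in> carrier_mat m p" and C: "C \<in> carrier_mat p m"
    and D: "D \<in> carrier_mat p p"
    and a: "a \<in> carrier_mat m 1" and b: "b \<in> carrier_mat p 1" and u: "u \<in> carrier_mat p 1"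
    and U: "unitary_mat (p + (1 + m))
      (four_block_mat D (u @\<^sub>c C) (b\<^sup>H @\<^sub>r B) (four_block_mat (w \<cdot>\<^sub>m 1\<^sub>m 1) (a\<^sup>H) (0\<^sub>m m 1) A))"
  shows "u\<^sup>H * u + (cnj w * w) \<cdot>\<^sub>m 1\<^sub>m 1 = 1\<^sub>m 1"
    and "u\<^sup>H * C + cnj w \<cdot>\<^sub>m a\<^sup>H = 0\<^sub>m 1 m"
    and "u\<^sup>H * D + cnj w \<cdot>\<^sub>m b\<^sup>H = 0\<^sub>m 1 p"
    and "D\<^sup>H * D + (b * b\<^sup>H + B\<^sup>H * B) = 1\<^sub>m p"
    and "D\<^sup>H * C + (b * a\<^sup>H + B\<^sup>H * A) = 0\<^sub>m p m"
    and "C\<^sup>H * C + (a * a\<^sup>H + A\<^sup>H * A) = 1\<^sub>m m"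
proof -
  let ?W = "w \<cdot>\<^sub>m 1\<^sub>m 1 :: complex mat"
  let ?At = "four_block_mat ?W (a\<^sup>H) (0\<^sub>m m 1) A" and ?Bt = "b\<^sup>H @\<^sub>r B" and ?Ct = "u @\<^sub>c C"
  let ?M = "four_block_mat D ?Ct ?Bt ?At"
  have At: "?At \<in> carrier_mat (1 + m) (1 + m)" and Bt: "?Bt \<in> carrier_mat (1 + m) p" and Ct: "?Ct \<in> carrier_mat p (1 + m)"
    using A B C a b u by (auto intro!: four_block_carrier_mat carrier_append_rows append_cols_carrier)
  have H: "A\<^sup>H \<in> carrier_mat m m" "B\<^sup>H \<in> carrier_mat p m" "C\<^sup>H \<in> carrier_mat m p" "D\<^sup>H \<in> carrier_mat p p"
    "a\<^sup>H \<in> carrier_mat 1 m" "b\<^sup>H \<in> carrier_mat 1 p" "u\<^sup>H \<in> carrier_mat 1 p" "?W \<in> carrier_mat 1 1"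
    "?W\<^sup>H \<in> carrier_mat 1 1"
    using A B C D a b u by auto
  have tH: "?At\<^sup>H \<in> carrier_mat (1 + m) (1 + m)" "?Bt\<^sup>H \<in> carrier_mat p (1 + m)" "?Ct\<^sup>H \<in> carrier_mat (1 + m) p"
    using At Bt Ct by (simp_all only: adjoint_carrier)
  have MH: "?M\<^sup>H = four_block_mat (D\<^sup>H) (?Bt\<^sup>H) (?Ct\<^sup>H) (?At\<^sup>H)"
    by (rule adjoint_four_block[OF D Ct Bt At])
  have AtH: "?At\<^sup>H = four_block_mat (?W\<^sup>H) (0\<^sub>m 1 m) a (A\<^sup>H)"
    using adjoint_four_block[OF H(8,5) zero_carrier_mat A] by simp
  have BtH: "?Bt\<^sup>H = b @\<^sub>c B\<^sup>H" using adjoint_append_rows[OF H(6) B] by simp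
  have CtH: "?Ct\<^sup>H = u\<^sup>H @\<^sub>r C\<^sup>H" by (rule adjoint_append_cols[OF u C])
  have "four_block_mat (D\<^sup>H * D + ?Bt\<^sup>H * ?Bt) (D\<^sup>H * ?Ct + ?Bt\<^sup>H * ?At) (?Ct\<^sup>H * D + ?At\<^sup>H * ?Bt) (?Ct\<^sup>H * ?Ct + ?At\<^sup>H * ?At)
     = ?M\<^sup>H * ?M"
    unfolding MH by (rule mult_four_block_mat[symmetric, OF H(4) tH(2,3,1) D Ct Bt At])
  also have "\<dots> = four_block_mat (1\<^sub>m p) (0\<^sub>m p (1 + m)) (0\<^sub>m (1 + m) p) (1\<^sub>m (1 + m))"
    using U by (simp add: unitary_mat_def)
  finally have cols: "D\<^sup>H * D + ?Bt\<^sup>H * ?Bt = 1\<^sub>m p" "D\<^sup>H * ?Ct + ?Bt\<^sup>H * ?At = 0\<^sub>m p (1 + m)"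
    "?Ct\<^sup>H * ?Ct + ?At\<^sup>H * ?At = 1\<^sub>m (1 + m)"
    by (subst (asm) four_block_eq_iff[of _ p p _ "1 + m" _ "1 + m"];
      use H tH D Ct Bt At in \<open>blast intro: add_carrier_mat mult_carrier_mat zero_carrier_mat one_carrier_mat\<close>)+

  show "D\<^sup>H * D + (b * b\<^sup>H + B\<^sup>H * B) = 1\<^sub>m p"
    using cols(1) unfolding BtH append_cols_mult_append_rows[OF b H(2) H(6) B] .

  have DC: "D\<^sup>H * ?Ct = D\<^sup>H * u @\<^sub>c D\<^sup>H * C" by (rule mult_append_cols[OF H(4) u C])
  have BA: "?Bt\<^sup>H * ?At = (b * ?W + B\<^sup>H * 0\<^sub>m m 1) @\<^sub>c (b * a\<^sup>H + B\<^sup>H * A)"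
    unfolding BtH by (rule append_cols_mult_four_block[OF b H(2,8,5) zero_carrier_mat A])
  have bW: "b * ?W + B\<^sup>H * 0\<^sub>m m 1 = w \<cdot>\<^sub>m b"
    using B b by (simp add: smult_one_mult(2)[OF b])
  have Du: "D\<^sup>H * u \<in> carrier_mat p 1" "w \<cdot>\<^sub>m b \<in> carrier_mat p 1"
    and DCc: "D\<^sup>H * C \<in> carrier_mat p m" "b * a\<^sup>H + B\<^sup>H * A \<in> carrier_mat p m"
    using H A C u b by (auto intro!: add_carrier_mat mult_carrier_mat[OF b H(5)] mult_carrier_mat[OF H(2) A])
  have "(D\<^sup>H * u + w \<cdot>\<^sub>m b) @\<^sub>c (D\<^sup>H * C + (b * a\<^sup>H + B\<^sup>H * A)) = 0\<^sub>m p 1 @\<^sub>c 0\<^sub>m p m"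
  proof -
    have "(P + R) @\<^sub>c (Q + S) = (P @\<^sub>c Q) + (R @\<^sub>c S)"
      if "P \<in> carrier_mat p 1" "R \<in> carrier_mat p 1" "Q \<in> carrier_mat p m" "S \<in> carrier_mat p m"
      for P Q R S :: "complex mat"
      by (rule eq_matI) (use that in auto)
    from this[OF Du DCc] have "(D\<^sup>H * u + w \<cdot>\<^sub>m b) @\<^sub>c (D\<^sup>H * C + (b * a\<^sup>H + B\<^sup>H * A)) = 0\<^sub>m p (1 + m)"
      using cols(2) unfolding DC BA bW by simp
    also have "\<dots> = 0\<^sub>m p 1 @\<^sub>c 0\<^sub>m p m" by (rule eq_matI) auto
    finally show ?thesis .
  qed
  hence mid: "D\<^sup>H * u + w \<cdot>\<^sub>m b = 0\<^sub>m p 1" "D\<^sup>H * C + (b * a\<^sup>H + B\<^sup>H * A) = 0\<^sub>m p m"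
    by (subst (asm) append_cols_eq_iff[of _ p 1 _ m];
      use Du DCc in \<open>blast intro: add_carrier_mat zero_carrier_mat\<close>)+
  show "D\<^sup>H * C + (b * a\<^sup>H + B\<^sup>H * A) = 0\<^sub>m p m" by (rule mid(2))
  have "(D\<^sup>H * u + w \<cdot>\<^sub>m b)\<^sup>H = 0\<^sub>m 1 p" unfolding mid(1) by simp
  thus "u\<^sup>H * D + cnj w \<cdot>\<^sub>m b\<^sup>H = 0\<^sub>m 1 p"
    unfolding adjoint_add[OF Du] adjoint_mult[OF H(4) u] by simp

  have CC: "?Ct\<^sup>H * ?Ct = four_block_mat (u\<^sup>H * u) (u\<^sup>H * C) (C\<^sup>H * u) (C\<^sup>H * C)"
    unfolding CtH by (rule append_rows_mult_append_cols[OF H(7,3) u C])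
  have AA: "?At\<^sup>H * ?At = four_block_mat (?W\<^sup>H * ?W + 0\<^sub>m 1 m * 0\<^sub>m m 1) (?W\<^sup>H * a\<^sup>H + 0\<^sub>m 1 m * A)
    (a * ?W + A\<^sup>H * 0\<^sub>m m 1) (a * a\<^sup>H + A\<^sup>H * A)"
    unfolding AtH by (rule mult_four_block_mat[OF H(9) zero_carrier_mat a H(1) H(8,5) zero_carrier_mat A])
  have 1: "?W\<^sup>H * ?W + 0\<^sub>m 1 m * 0\<^sub>m m 1 = (cnj w * w) \<cdot>\<^sub>m 1\<^sub>m 1"
    by (simp add: smult_one_mult[of _ 1 1] smult_smult_mat mult.commute)
  have 2: "?W\<^sup>H * a\<^sup>H + 0\<^sub>m 1 m * A = cnj w \<cdot>\<^sub>m a\<^sup>H"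
    using A a by (simp add: smult_one_mult(1)[OF H(5)])
  have 3: "a * ?W + A\<^sup>H * 0\<^sub>m m 1 \<in> carrier_mat m 1" "a * a\<^sup>H + A\<^sup>H * A \<in> carrier_mat m m"
    by (intro add_carrier_mat mult_carrier_mat[OF H(1) zero_carrier_mat] mult_carrier_mat[OF H(1) A])+
  have 4: "u\<^sup>H * u \<in> carrier_mat 1 1" "u\<^sup>H * C \<in> carrier_mat 1 m" "C\<^sup>H * u \<in> carrier_mat m 1" "C\<^sup>H * C \<in> carrier_mat m m"
    using mult_carrier_mat[OF H(7) u] mult_carrier_mat[OF H(7) C] mult_carrier_mat[OF H(3) u] mult_carrier_mat[OF H(3) C] .
  have 5: "(cnj w * w) \<cdot>\<^sub>m 1\<^sub>m 1 \<in> carrier_mat 1 1" "cnj w \<cdot>\<^sub>m a\<^sup>H \<in> carrier_mat 1 m" using H by auto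
  have "four_block_mat (u\<^sup>H * u + (cnj w * w) \<cdot>\<^sub>m 1\<^sub>m 1) (u\<^sup>H * C + cnj w \<cdot>\<^sub>m a\<^sup>H)
    (C\<^sup>H * u + (a * ?W + A\<^sup>H * 0\<^sub>m m 1)) (C\<^sup>H * C + (a * a\<^sup>H + A\<^sup>H * A)) =
    ?Ct\<^sup>H * ?Ct + ?At\<^sup>H * ?At"
    unfolding CC AA 1 2 by (rule add_four_block_mat[symmetric, OF 4 5 3])
  also have "\<dots> = four_block_mat (1\<^sub>m 1) (0\<^sub>m 1 m) (0\<^sub>m m 1) (1\<^sub>m m)" unfolding cols(3) by simp
  finally have "u\<^sup>H * u + (cnj w * w) \<cdot>\<^sub>m 1\<^sub>m 1 = 1\<^sub>m 1 \<and> u\<^sup>H * C + cnj w \<cdot>\<^sub>m a\<^sup>H = 0\<^sub>m 1 m \<and>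
    C\<^sup>H * u + (a * ?W + A\<^sup>H * 0\<^sub>m m 1) = 0\<^sub>m m 1 \<and> C\<^sup>H * C + (a * a\<^sup>H + A\<^sup>H * A) = 1\<^sub>m m"
    by (subst (asm) four_block_eq_iff[of _ 1 1 _ m _ m])
      (use 3 4 5 in \<open>blast intro: add_carrier_mat zero_carrier_mat one_carrier_mat\<close>)+
  thus "u\<^sup>H * u + (cnj w * w) \<cdot>\<^sub>m 1\<^sub>m 1 = 1\<^sub>m 1" "u\<^sup>H * C + cnj w \<cdot>\<^sub>m a\<^sup>H = 0\<^sub>m 1 m"
    "C\<^sup>H * C + (a * a\<^sup>H + A\<^sup>H * A) = 1\<^sub>m m" by blast+
qed

text \<open>If \<open>u = 0\<close>, the first state is unobservable, and the remaining \<open>m\<close> states already realize \<open>G\<close>,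
  against minimality.\<close>

lemma schur_column_nonzero:
  assumes A: "A \<in> carrier_mat m m" and B: "B \<in> carrier_mat m p" and C: "C \<in> carrier_mat p m"
    and D: "D \<in> carrier_mat p p"
    and a: "a \<in> carrier_mat 1 m" and b: "b \<in> carrier_mat 1 p" and u: "u \<in> carrier_mat p 1"
    and min: "minimal_realization p (1 + m) G
      (four_block_mat (w \<cdot>\<^sub>m 1\<^sub>m 1) a (0\<^sub>m m 1) A) (b @\<^sub>r B) (u @\<^sub>c C) D"
  shows "u \<noteq> 0\<^sub>m p 1"
proof
  assume u0: "u = 0\<^sub>m p 1"
  have deg: "mcmillan_degree p G = 1 + m"
    and G: "G = const_mat D + const_mat (u @\<^sub>c C) *
      resolvent (four_block_mat (w \<cdot>\<^sub>m 1\<^sub>m 1) a (0\<^sub>m m 1) A) * const_mat (b @\<^sub>r B)"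
    using min by (auto simp: minimal_realization_def realization_def)
  note R = resolvent_carrier[OF A]
  have CRB: "const_mat C * resolvent A * const_mat B \<in> carrier_mat p p"
    using B C R by auto
  have "const_mat a * resolvent A * const_mat B \<in> carrier_mat 1 p"
    using B a by (auto intro!: mult_carrier_mat[OF mult_carrier_mat[OF _ R]])
  hence E: "const_mat b + const_mat a * resolvent A * const_mat B \<in> carrier_mat 1 p"
    by (rule add_carrier_mat)
  have "const_mat u * (const_mat b + const_mat a * resolvent A * const_mat B) = 0\<^sub>m p p"
    unfolding u0 const_mat_zero by (rule left_mult_zero_mat[OF E])
  hence "G = const_mat D + const_mat C * resolvent A * const_mat B"
    unfolding G transfer_function_block_triangular[OF A B C a b u] using CRB by simp
  hence "realization p m G A B C D" using A B C D by (simp add: realization_def)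
  hence "mcmillan_degree p G \<le> m" unfolding mcmillan_degree_def by (intro Least_le) blast
  with deg show False by simp
qed

text \<open>\<open>1 - |w|\<^sup>2\<close> is the squared norm of \<open>u\<close>, which is positive.\<close>

lemma schur_step_of_unitary:
  assumes u: "u \<in> carrier_mat p 1" "u \<noteq> 0\<^sub>m p 1" and uu: "u\<^sup>H * u + (cnj w * w) \<cdot>\<^sub>m 1\<^sub>m 1 = 1\<^sub>m 1"
  shows "schur_step p w u"
proof
  have uuc: "u\<^sup>H * u \<in> carrier_mat 1 1" using mult_carrier_mat[of "u\<^sup>H" 1 p u 1] u by simp
  show eq: "u\<^sup>H * u = (1 - cnj w * w) \<cdot>\<^sub>m 1\<^sub>m 1"
  proof (rule eq_matI)
    fix i j assume "i < dim_row ((1 - cnj w * w) \<cdot>\<^sub>m 1\<^sub>m 1)" "j < dim_col ((1 - cnj w * w) \<cdot>\<^sub>m 1\<^sub>m 1)"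
    with arg_cong[OF uu, of "\<lambda>X. X $$ (i, j)"] carrier_matD[OF uuc]
    show "(u\<^sup>H * u) $$ (i, j) = ((1 - cnj w * w) \<cdot>\<^sub>m 1\<^sub>m 1) $$ (i, j)"
      by (simp add: One_nat_def eq_diff_eq del: index_mult_mat)
  qed (use u in auto)
  let ?S = "\<Sum>i<p. (cmod (u $$ (i, 0)))\<^sup>2"
  have "?S \<noteq> 0"
  proof
    assume "?S = 0"
    hence "u $$ (i, 0) = 0" if "i < p" for i using that by (simp add: sum_nonneg_eq_0_iff)
    hence "u = 0\<^sub>m p 1" using u(1) by (intro eq_matI) (auto simp: One_nat_def)
    with u(2) show False ..
  qed
  moreover have "?S \<ge> 0" by (rule sum_nonneg) simp
  ultimately have S: "?S > 0" by linarith
  have "complex_of_real ?S = 1 - cnj w * w"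
    unfolding column_gram[OF u(1), symmetric] eq by (simp add: One_nat_def)
  also have "\<dots> = complex_of_real (1 - (cmod w)\<^sup>2)"
    unfolding of_real_diff complex_norm_square by (simp add: mult.commute)
  finally have "?S = 1 - (cmod w)\<^sup>2" by (rule of_real_eq_iff[THEN iffD1])
  with S have "(cmod w)\<^sup>2 < 1\<^sup>2" by simp
  thus "cmod w < 1" by (rule power2_less_imp_less) simp
qed (use u in auto)

text \<open>With \<open>E = b + a (z - A)^-1 B\<close> and \<open>F = Dt + Chat (z - A)^-1 B\<close> the left side is
  \<open>F + u E / (z - w)\<close> and the second factor on the right is \<open>F + u E / (1 - w)\<close>. The two orthogonality relations
  combine to \<open>u\<^sup>H F = - cnj w E\<close>, which is the hypothesis of \<open>blaschke_factor\<close>.\<close>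

lemma (in schur_step) transfer_function_reduction:
  assumes A: "A \<in> carrier_mat m m" and B: "B \<in> carrier_mat m p" and Chat: "Chat \<in> carrier_mat p m"
    and Dt: "Dt \<in> carrier_mat p p" and a: "a \<in> carrier_mat 1 m" and b: "b \<in> carrier_mat 1 p"
    and orthC: "u\<^sup>H * Chat = - cnj w \<cdot>\<^sub>m a" and orthD: "u\<^sup>H * Dt = - cnj w \<cdot>\<^sub>m b"
  shows "const_mat Dt + const_mat (u @\<^sub>c Chat) * resolvent (four_block_mat W a (0\<^sub>m m 1) A) * const_mat (b @\<^sub>r B) =
    blaschke * (const_mat (Dt + inverse (1 - w) \<cdot>\<^sub>m (u * b)) +
      const_mat (Chat + inverse (1 - w) \<cdot>\<^sub>m (u * a)) * resolvent A * const_mat B)"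
proof -
  define R where "R = resolvent A"
  let ?B = "const_mat B" and ?u = "const_mat u" and ?a = "const_mat a" and ?b = "const_mat b"
    and ?C = "const_mat Chat" and ?D = "const_mat Dt" and ?s = "to_fract [:inverse (1 - w):]" and ?uH = "const_mat (u\<^sup>H)"
  have c: "R \<in> carrier_mat m m" "?B \<in> carrier_mat m p" "?u \<in> carrier_mat p 1" "?a \<in> carrier_mat 1 m"
    "?b \<in> carrier_mat 1 p" "?C \<in> carrier_mat p m" "?D \<in> carrier_mat p p" "?uH \<in> carrier_mat 1 p"
    using resolvent_carrier[OF A] B a b Chat Dt unfolding R_def by auto
  note CR = mult_carrier_mat[OF c(6,1)] and aR = mult_carrier_mat[OF c(4,1)]
    and ub = mult_carrier_mat[OF c(3,5)] and ua = mult_carrier_mat[OF c(3,4)]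
  note CRB = mult_carrier_mat[OF CR c(2)] and aRB = mult_carrier_mat[OF aR c(2)]
  note uaRB = mult_carrier_mat[OF c(3) aRB] and sua = smult_carrier_mat[OF ua, of ?s]
  \<comment> \<open>\<open>E\<close> is the input of the first state, \<open>F\<close> the part of the output that bypasses it.\<close>
  define E where "E = ?b + ?a * R * ?B"
  define F where "F = ?D + ?C * R * ?B"
  have E: "E \<in> carrier_mat 1 p" and F: "F \<in> carrier_mat p p"
    unfolding E_def F_def by (rule add_carrier_mat[OF aRB], rule add_carrier_mat[OF CRB])
  have uE: "?u * E \<in> carrier_mat p p" by (rule mult_carrier_mat[OF c(3) E])
  have orth: "?uH * F = - to_fract [:cnj w:] \<cdot>\<^sub>m E"
  proof -
    have neg: "to_fract [:- cnj w:] = - to_fract [:cnj w:]" by (simp flip: to_fract_uminus)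
    have "?uH * F = ?uH * ?D + ?uH * (?C * R * ?B)"
      unfolding F_def by (rule mult_add_distrib_mat[OF c(8,7) CRB])
    also have "?uH * ?D = - to_fract [:cnj w:] \<cdot>\<^sub>m ?b"
      unfolding const_mat_mult[OF uH Dt, symmetric] orthD const_mat_smult neg ..
    also have "?uH * (?C * R * ?B) = ?uH * ?C * R * ?B"
      unfolding assoc_mult_mat[OF c(8) CR c(2), symmetric] assoc_mult_mat[OF c(8,6,1)] ..
    also have "?uH * ?C = - to_fract [:cnj w:] \<cdot>\<^sub>m ?a"
      unfolding const_mat_mult[OF uH Chat, symmetric] orthC const_mat_smult neg ..
    also have "- to_fract [:cnj w:] \<cdot>\<^sub>m ?a * R * ?B = - to_fract [:cnj w:] \<cdot>\<^sub>m (?a * R * ?B)"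
      unfolding mult_smult_assoc_mat[OF c(4,1)] mult_smult_assoc_mat[OF aR c(2)] ..
    finally show ?thesis unfolding E_def by (simp only: add_smult_distrib_left_mat[OF c(5) aRB])
  qed
  have "?D + const_mat (u @\<^sub>c Chat) * resolvent (four_block_mat W a (0\<^sub>m m 1) A) * const_mat (b @\<^sub>r B) =
    ?D + (?C * R * ?B + inv_z_minus_w \<cdot>\<^sub>m (?u * E))"
    unfolding transfer_function_block_triangular[OF A B Chat a b u] E_def R_def inv_z_minus_w_def ..
  also have "\<dots> = F + inv_z_minus_w \<cdot>\<^sub>m (?u * E)"
    unfolding F_def by (rule assoc_add_mat[symmetric, OF c(7) CRB smult_carrier_mat[OF uE]])
  also have "\<dots> = blaschke * (F + ?s \<cdot>\<^sub>m (?u * E))" by (rule blaschke_factor[OF F E orth])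
  also have "F + ?s \<cdot>\<^sub>m (?u * E) =
    (?D + ?s \<cdot>\<^sub>m (?u * ?b)) + (?C * R * ?B + ?s \<cdot>\<^sub>m (?u * (?a * R * ?B)))"
  proof -
    have "P + Q + s \<cdot>\<^sub>m (S + T) = (P + s \<cdot>\<^sub>m S) + (Q + s \<cdot>\<^sub>m T)"
      if "P \<in> carrier_mat p p" "Q \<in> carrier_mat p p" "S \<in> carrier_mat p p" "T \<in> carrier_mat p p"
      for s and P Q S T :: "complex poly fract mat"
      by (rule eq_matI) (use that in \<open>auto simp: algebra_simps\<close>)
    from this[OF c(7) CRB ub uaRB] show ?thesis
      unfolding F_def E_def mult_add_distrib_mat[OF c(3,5) aRB] .
  qed
  also have "?D + ?s \<cdot>\<^sub>m (?u * ?b) = const_mat (Dt + inverse (1 - w) \<cdot>\<^sub>m (u * b))"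
    unfolding const_mat_add[OF Dt smult_carrier_mat[OF mult_carrier_mat[OF u b]]] const_mat_smult const_mat_mult[OF u b] ..
  also have "?C * R * ?B + ?s \<cdot>\<^sub>m (?u * (?a * R * ?B)) = (?C + ?s \<cdot>\<^sub>m (?u * ?a)) * R * ?B"
    unfolding add_mult_distrib_mat[OF c(6) sua c(1)] mult_smult_assoc_mat[OF ua c(1)] assoc_mult_mat[OF c(3,4,1)]
      add_mult_distrib_mat[OF CR smult_carrier_mat[OF mult_carrier_mat[OF c(3) aR]] c(2)]
      mult_smult_assoc_mat[OF mult_carrier_mat[OF c(3) aR] c(2)] assoc_mult_mat[OF c(3) aR c(2)] ..
  also have "?C + ?s \<cdot>\<^sub>m (?u * ?a) = const_mat (Chat + inverse (1 - w) \<cdot>\<^sub>m (u * a))"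
    unfolding const_mat_add[OF Chat smult_carrier_mat[OF mult_carrier_mat[OF u a]]] const_mat_smult const_mat_mult[OF u a] ..
  finally show ?thesis unfolding R_def .
qed

theorem lemma1:
  fixes p n :: nat
    and Gt :: "complex poly fract mat"
    and At Bt Ct Dt A B Chat W u a b UU VV :: "complex mat"
    and w :: complex
  assumes "n \<ge> 1"
    and "Gt \<in> lossless_deg p n"
    and "balanced_realization p n Gt At Bt Ct Dt"
    and "upper_triangular At"
    and "u \<in> carrier_mat p 1" and "b \<in> carrier_mat p 1" and "a \<in> carrier_mat (n - 1) 1"
    and "A \<in> carrier_mat (n - 1) (n - 1)" and "B \<in> carrier_mat (n - 1) p"
    and "Chat \<in> carrier_mat p (n - 1)"
    and "W = mat 1 1 (\<lambda>_. w)"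
    and "At = four_block_mat W (a\<^sup>H) (0\<^sub>m (n - 1) 1) A"
    and "Bt = b\<^sup>H @\<^sub>r B"
    and "Ct = u @\<^sub>c Chat"
    and "tau W u (0\<^sub>m p 1) = (UU, VV)"
  shows "tau_admissible p 1 W u (0\<^sub>m p 1) \<and>
    (\<exists>G C D. lossless p G \<and> is_LFT p (Theta_hat W u (0\<^sub>m p 1)) G Gt \<and>
       C = Chat + inverse (1 - w) \<cdot>\<^sub>m (u * a\<^sup>H) \<and>
       D = Dt + inverse (1 - w) \<cdot>\<^sub>m (u * b\<^sup>H) \<and>
       realization p (n - 1) G A B C D \<and> upper_triangular A \<and>
       (\<forall>A' \<in> carrier_mat (n - 1) (n - 1). \<forall>B' \<in> carrier_mat (n - 1) p.
        \<forall>C' \<in> carrier_mat p (n - 1). \<forall>D' \<in> carrier_mat p p.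
          recursion p (n - 1) UU VV At Bt Ct Dt A' B' C' D' \<longleftrightarrow>
          A' = A \<and> B' = B \<and> C' = C \<and> D' = D))"
proof -
  define m where "m = n - 1"
  have n: "n = 1 + m" using assms(1) by (simp add: m_def)
  note u = assms(5) and b = assms(6)
  have a: "a \<in> carrier_mat m 1" and A: "A \<in> carrier_mat m m"
    and B: "B \<in> carrier_mat m p" and Chat: "Chat \<in> carrier_mat p m"
    using assms(7-10) by (simp_all add: m_def)
  have W: "W = w \<cdot>\<^sub>m 1\<^sub>m 1" unfolding assms(11) by (rule eq_matI) auto
  have At: "At = four_block_mat (w \<cdot>\<^sub>m 1\<^sub>m 1) (a\<^sup>H) (0\<^sub>m m 1) A" using assms(12) by (simp add: W m_def)
  have bal: "balanced_realization p (1 + m) Gt (four_block_mat (w \<cdot>\<^sub>m 1\<^sub>m 1) (a\<^sup>H) (0\<^sub>m m 1) A)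
      (b\<^sup>H @\<^sub>r B) (u @\<^sub>c Chat) Dt"
    using assms(3) unfolding n At assms(13,14) .
  have Dt: "Dt \<in> carrier_mat p p"
    and U: "unitary_mat (p + (1 + m))
      (four_block_mat Dt (u @\<^sub>c Chat) (b\<^sup>H @\<^sub>r B) (four_block_mat (w \<cdot>\<^sub>m 1\<^sub>m 1) (a\<^sup>H) (0\<^sub>m m 1) A))"
    and Gt: "Gt = const_mat Dt + const_mat (u @\<^sub>c Chat) *
      resolvent (four_block_mat (w \<cdot>\<^sub>m 1\<^sub>m 1) (a\<^sup>H) (0\<^sub>m m 1) A) * const_mat (b\<^sup>H @\<^sub>r B)"
    using bal by (auto simp: balanced_realization_def minimal_realization_def realization_def)
  note rel = unitary_schur_relations[OF A B Chat Dt a b u U]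
  have aH: "a\<^sup>H \<in> carrier_mat 1 m" and bH: "b\<^sup>H \<in> carrier_mat 1 p" using a b by auto
  have min: "minimal_realization p (1 + m) Gt (four_block_mat (w \<cdot>\<^sub>m 1\<^sub>m 1) (a\<^sup>H) (0\<^sub>m m 1) A)
      (b\<^sup>H @\<^sub>r B) (u @\<^sub>c Chat) Dt"
    using bal by (simp add: balanced_realization_def)
  interpret schur_step p w u
    by (rule schur_step_of_unitary[OF u schur_column_nonzero[OF A B Chat Dt aH bH u min] rel(1)])
  have tau: "UU = four_block_mat X u Y (w \<cdot>\<^sub>m 1\<^sub>m 1)" "VV = 1\<^sub>m (p + 1)"
    using assms(15) unfolding W tau_eq by simp_all

  define C where "C = Chat + inverse (1 - w) \<cdot>\<^sub>m (u * a\<^sup>H)"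
  define D where "D = Dt + inverse (1 - w) \<cdot>\<^sub>m (u * b\<^sup>H)"
  define G where "G = const_mat D + const_mat C * resolvent A * const_mat B"
  have C: "C \<in> carrier_mat p m" and D: "D \<in> carrier_mat p p"
    unfolding C_def D_def
    by (intro add_carrier_mat smult_carrier_mat mult_carrier_mat[OF u aH] mult_carrier_mat[OF u bH])+
  have orthC: "u\<^sup>H * Chat = - cnj w \<cdot>\<^sub>m a\<^sup>H"
    by (rule minus_eqI_mat[OF rel(2) mult_carrier_mat[OF uH Chat] aH])
  have orthD: "u\<^sup>H * Dt = - cnj w \<cdot>\<^sub>m b\<^sup>H"
    by (rule minus_eqI_mat[OF rel(3) mult_carrier_mat[OF uH Dt] bH])
  \<comment> \<open>Both columns of the reduced realization come from the same inversion of \<open>(X; Y)\<close>.\<close>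
  have stepC: "X * C' = Chat \<and> Y * C' = a\<^sup>H \<longleftrightarrow> C' = C" if "C' \<in> carrier_mat p m" for C'
    unfolding C_def by (rule step_inverse[OF that Chat aH orthC])
  have stepD: "X * D' = Dt \<and> Y * D' = b\<^sup>H \<longleftrightarrow> D' = D" if "D' \<in> carrier_mat p p" for D'
    unfolding D_def by (rule step_inverse[OF that Dt bH orthD])
  have XC: "X * C = Chat" "Y * C = a\<^sup>H" and XD: "X * D = Dt" "Y * D = b\<^sup>H"
    using stepC[OF C] stepD[OF D] by simp_all

  have rec: "recursion p m UU VV At Bt Ct Dt A' B' C' D' \<longleftrightarrow> A' = A \<and> B' = B \<and> C' = C \<and> D' = D"
    if "A' \<in> carrier_mat m m" "B' \<in> carrier_mat m p" "C' \<in> carrier_mat p m" "D' \<in> carrier_mat p p"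
    for A' B' C' D'
    unfolding tau At assms(13,14)
      recursion_iff[OF A B Chat Dt aH bH that] stepC[OF that(3)] stepD[OF that(4)] ..

  have real: "realization p m G A B C D"
    using A B C D by (simp add: realization_def G_def)
  have unit: "unitary_mat (p + m) (four_block_mat D C B A)"
  proof (rule unitary_if_isometric_blocks[OF A B C D])
    have H: "A\<^sup>H \<in> carrier_mat m m" "B\<^sup>H \<in> carrier_mat p m" "Chat\<^sup>H \<in> carrier_mat m p" "Dt\<^sup>H \<in> carrier_mat p p"
      using A B Chat Dt by auto
    have "D\<^sup>H * D = Dt\<^sup>H * Dt + b * b\<^sup>H" using gram_transfer[OF D D] by (simp add: XD)
    thus "D\<^sup>H * D + B\<^sup>H * B = 1\<^sub>m p"
      using rel(4) assoc_add_mat[OF mult_carrier_mat[OF H(4) Dt] mult_carrier_mat[OF b bH] mult_carrier_mat[OF H(2) B]]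
      by simp
    have "D\<^sup>H * C = Dt\<^sup>H * Chat + b * a\<^sup>H" using gram_transfer[OF D C] by (simp add: XD XC)
    thus "D\<^sup>H * C + B\<^sup>H * A = 0\<^sub>m p m"
      using rel(5) assoc_add_mat[OF mult_carrier_mat[OF H(4) Chat] mult_carrier_mat[OF b aH] mult_carrier_mat[OF H(2) A]]
      by simp
    have "C\<^sup>H * C = Chat\<^sup>H * Chat + a * a\<^sup>H" using gram_transfer[OF C C] by (simp add: XC)
    thus "C\<^sup>H * C + A\<^sup>H * A = 1\<^sub>m m"
      using rel(6) assoc_add_mat[OF mult_carrier_mat[OF H(3) Chat] mult_carrier_mat[OF a aH] mult_carrier_mat[OF H(1) A]]
      by simp
  qed
  have lossless: "lossless p G" by (rule lossless_if_unitary_realization[OF real unit])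
  have LFT: "is_LFT p (Theta_hat (w \<cdot>\<^sub>m 1\<^sub>m 1) u (0\<^sub>m p 1)) G Gt"
  proof (rule is_LFT_Theta_hat)
    show "G \<in> carrier_mat p p" using lossless by (simp add: lossless_def)
    show "Gt = blaschke * G"
      unfolding Gt G_def C_def D_def
      by (rule transfer_function_reduction[OF A B Chat Dt aH bH orthC orthD])
  qed

  have "upper_triangular A"
  proof (rule upper_triangularI)
    fix i j assume ij: "j < i" "i < dim_row A"
    have "At $$ (1 + i, 1 + j) = 0"
      by (rule upper_triangularD[OF assms(4)]) (use ij A in \<open>auto simp: At\<close>)
    thus "A $$ (i, j) = 0" using ij A by (simp add: At)
  qed
  thus ?thesis
    unfolding m_def[symmetric] W
    using tau_admissible lossless LFT C_def D_def real rec by blast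
qed

end
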